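(* Let $X=X_{A,A_1,V_5}$ be the GM intersection associated with an extended Lagrangian data $(V_6,V_5,A,A_1)$ with $A_1\ne\infty$, and let $W(X)=W(X)_0\oplus W(X)_1$ and $\mathbf{q}$ be the associated spaces and map. Set $L=(V_6/V_5)^\vee$. (a) We have $$W(X)_0=A/(A\cap\textstyle\bigwedge^3V_5),\qquad W(X)_1=A_1/(A_1\cap L),$$ $$W(X)_0^\perp=A\cap\textstyle\bigwedge^3V_5,\qquad W(X)_1^\perp=A_1\cap L.$$ (b) For $v\in V_6\smallsetminus V_5$, we have $$\mathrm{Ker}(\mathbf{q}(v))=A\cap(v\wedge\textstyle\bigwedge^2V_5).$$ (c) If $X$ is a GM variety, we have $$\dim(X)=\begin{cases}5-\dim(A\cap\bigwedge^3V_5)&\text{if }A_1=0,\\6-\dim(A\cap\bigwedge^3V_5)&\text{if }A_1=1.\end{cases}$$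
   Context: Conventions. $\mathbf{k}$ is a subfield of $\mathbb{C}$; $\mathbb{P}(V)$ is the space of lines in $V$. GM varieties. Let $V_5$ be a $\mathbf{k}$-vector space of dimension $5$, $K$ a $\mathbf{k}$-vector space, and $\mathsf{C}_K\mathrm{Gr}(2,V_5)\subset\mathbb{P}(\bigwedge^2V_5\oplus K)$ the cone with vertex $\mathbb{P}(K)$ over the Plücker-embedded $\mathrm{Gr}(2,V_5)$. Let $W\subset\bigwedge^2V_5\oplus K$ be a subspace and $Q\subset\mathbb{P}(W)$ a subscheme defined by one (possibly zero) quadratic equation. $X=\mathsf{C}_K\mathrm{Gr}(2,V_5)\cap\mathbb{P}(W)\cap Q$ is a GM intersection; it is a GM variety if it is geometrically integral and $\dim X=\dim W-5\ge1$. Extended Lagrangian data $(V_6,V_5,A,A_1)$: a $6$-dimensional $\mathbf{k}$-vector space $V_6$, a hyperplane $V_5\subset V_6$, a Lagrangian subspace $A\subset\bigwedge^3V_6$ for the $\det(V_6)$-valued wedge product form, and a Lagrangian subspace (a line) $A_1\subset\mathbf{k}\oplus L$, $L:=(V_6/V_5)^\vee$, for the canonical $L$-valued symplectic form. Write $A_1=0$ if $A_1=L$, $A_1=\infty$ if $A_1=\mathbf{k}$, and $A_1=1$ otherwise. (The data is lci when $A_1\ne\infty$.) The GM intersection $X_{A,A_1,V_5}$. Let $\lambda:V_6\to V_6/V_5=L^\vee$ be the projection and $\lambda_p:\bigwedge^pV_6\to\bigwedge^{p-1}V_5\otimes L^\vee$ the induced map ($\lambda_p$ vanishes on $\bigwedge^pV_5$,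 and $\lambda_p(v\wedge\eta)=\lambda(v)\eta$ for $v\in V_6$, $\eta\in\bigwedge^{p-1}V_5$). Choose an isomorphism $\varepsilon:\det(V_5)\to L^{\otimes2}$. Let $W(X)_0=\lambda_3(A)\subset\bigwedge^2V_5\otimes L^\vee$, let $W(X)_1\subset\mathbf{k}$ be the image of the projection $A_1\to\mathbf{k}$, and $W(X)=W(X)_0\oplus W(X)_1$. Let $\mathbf{q}=\mathbf{q}_0+\mathbf{q}_1:V_6\to\mathrm{S}^2W(X)_0^\vee\oplus\mathrm{S}^2W(X)_1^\vee$ with $\mathbf{q}_0(v)(\lambda_3(\xi_1),\lambda_3(\xi_2))=-\varepsilon(\lambda_4(v\wedge\xi_1)\wedge\lambda_3(\xi_2))$ for $\xi_i\in A$, and $\mathbf{q}_1(v)$ induced by the form $((x_1,x_1'),(x_2,x_2'))\mapsto\lambda(v)x_1x_2'$ on $A_1$ (these are well defined and symmetric). Then $X_{A,A_1,V_5}=\bigcap_{v\in V_6}\{\mathbf{q}(v)=0\}\subset\mathbb{P}(W(X))$. Identifications. $W(X)_0^\perp$ is the annihilator of $W(X)_0\subset\bigwedge^2V_5\otimes L^\vee$ in $\bigwedge^3V_5$ (which is dual to $\bigwedge^2V_5\otimes L^\vee$ up to twist by a one-dimensional space, via the wedge product), and $W(X)_1^\perp$ is the annihilator of $W(X)_1\subset\mathbf{k}$ in $L$ (dual to $\mathbf{k}$ via the symplectic form on $\mathbf{k}\oplus L$). In (b), $A\cap(v\wedge\bigwedge^2V_5)$ is viewed in $W(X)_0$ via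 $\lambda_3$, which is injective on it. *)

theory Defs
  imports Complex_Main "HOL-Library.Function_Algebras" "HOL-Library.Product_Plus"
    "HOL-Algebra.Ideal"
begin

section \<open>Linear algebra\<close>

text \<open>The base field is a type \<open>'k\<close> together with an embedding into the complex numbers; the
  vector space \<open>V\<^sub>6\<close> is a type \<open>'v\<close> with a scalar multiplication \<open>s\<close>.  All other vector spaces
  are subsets of types of functions or of pairs.\<close>

definition field_embedding :: "('k::field \<Rightarrow> complex) \<Rightarrow> bool" where
  "field_embedding \<iota> \<longleftrightarrow> \<iota> 1 = 1 \<and> (\<forall>x y. \<iota> (x + y) = \<iota> x + \<iota> y \<and> \<iota> (x * y) = \<iota> x * \<iota> y)"

definition fscale :: "'k::field \<Rightarrow> ('x \<Rightarrow> 'k) \<Rightarrow> 'x \<Rightarrow> 'k" where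
  "fscale c f = (\<lambda>x. c * f x)"

definition linear_on ::
  "('k \<Rightarrow> 'a::ab_group_add \<Rightarrow> 'a) \<Rightarrow> ('k \<Rightarrow> 'b::ab_group_add \<Rightarrow> 'b) \<Rightarrow> 'a set \<Rightarrow> ('a \<Rightarrow> 'b) \<Rightarrow> bool"
  where
  "linear_on sa sb U f \<longleftrightarrow>
     (\<forall>x\<in>U. \<forall>y\<in>U. f (x + y) = f x + f y) \<and> (\<forall>c. \<forall>x\<in>U. f (sa c x) = sb c (f x))"

definition linear_iso_on ::
  "('k \<Rightarrow> 'a::ab_group_add \<Rightarrow> 'a) \<Rightarrow> ('k \<Rightarrow> 'b::ab_group_add \<Rightarrow> 'b) \<Rightarrow> 'a set \<Rightarrow> 'b set
     \<Rightarrow> ('a \<Rightarrow> 'b) \<Rightarrow> bool"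
  where
  "linear_iso_on sa sb U U' f \<longleftrightarrow> linear_on sa sb U f \<and> bij_betw f U U'"

text \<open>\<open>coset B x\<close> is \<open>x + B\<close> and \<open>quot_space U B\<close> is \<open>U/B\<close>, whose vector space structure is
  \<open>(x + B) + (y + B) = (x + y) + B\<close> and \<open>c (x + B) = c x + B\<close>.  The predicate
  \<open>induces_quotient_iso sa sb f U B U'\<close> says that \<open>f\<close> induces a linear isomorphism from \<open>U/B\<close>
  onto \<open>U'\<close>.\<close>

definition coset :: "'a::ab_group_add set \<Rightarrow> 'a \<Rightarrow> 'a set" where
  "coset B x = (\<lambda>b. x + b) ` B"

definition quot_space :: "'a::ab_group_add set \<Rightarrow> 'a set \<Rightarrow> 'a set set" where
  "quot_space U B = coset B ` U"

definition induces_quotient_iso ::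
  "('k \<Rightarrow> 'a::ab_group_add \<Rightarrow> 'a) \<Rightarrow> ('k \<Rightarrow> 'b::ab_group_add \<Rightarrow> 'b) \<Rightarrow> ('a \<Rightarrow> 'b)
     \<Rightarrow> 'a set \<Rightarrow> 'a set \<Rightarrow> 'b set \<Rightarrow> bool"
  where
  "induces_quotient_iso sa sb f U B U' \<longleftrightarrow>
     (\<exists>g. (\<forall>x\<in>U. g (coset B x) = f x)
        \<and> (\<forall>x\<in>U. \<forall>y\<in>U. g (coset B (x + y)) = g (coset B x) + g (coset B y))
        \<and> (\<forall>c. \<forall>x\<in>U. g (coset B (sa c x)) = sb c (g (coset B x)))
        \<and> bij_betw g (quot_space U B) U')"

definition lagrangian ::
  "('k::field \<Rightarrow> 'a::ab_group_add \<Rightarrow> 'a) \<Rightarrow> 'a set \<Rightarrow> ('a \<Rightarrow> 'a \<Rightarrow> 'b::zero) \<Rightarrow> 'a set \<Rightarrow> bool"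
  where
  "lagrangian sa E form U \<longleftrightarrow>
     module.subspace sa U \<and> U \<subseteq> E \<and> U = {x \<in> E. \<forall>y\<in>U. form x y = 0}"


section \<open>Exterior powers\<close>

text \<open>The exterior power \<open>\<Lambda>\<^sup>p V\<close> is realised as the space of functionals on alternating
  \<open>p\<close>-forms spanned by the evaluations \<open>v\<^sub>1 \<and> \<dots> \<and> v\<^sub>p = (\<omega> \<mapsto> \<omega>(v\<^sub>1, \<dots>, v\<^sub>p))\<close>; over a field,
  alternating forms separate the points of \<open>\<Lambda>\<^sup>p V\<close>.  Forms are functions on lists that
  vanish on lists of the wrong length, and a \<open>p\<close>-vector is extended by \<open>0\<close> to all functions on
  lists, so that equality of \<open>p\<close>-vectors is equality of functions.\<close>

type_synonym ('v, 'k) multivector = "('v list \<Rightarrow> 'k) \<Rightarrow> 'k"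

definition alt_forms :: "('k::field \<Rightarrow> 'v::ab_group_add \<Rightarrow> 'v) \<Rightarrow> nat \<Rightarrow> ('v list \<Rightarrow> 'k) set" where
  "alt_forms s p = {\<omega>.
     (\<forall>vs. length vs \<noteq> p \<longrightarrow> \<omega> vs = 0) \<and>
     (\<forall>vs i. length vs = p \<longrightarrow> i < p \<longrightarrow> Vector_Spaces.linear s (*) (\<lambda>x. \<omega> (vs[i := x]))) \<and>
     (\<forall>vs. length vs = p \<longrightarrow> \<not> distinct vs \<longrightarrow> \<omega> vs = 0)}"

definition decomposable ::
  "('k::field \<Rightarrow> 'v::ab_group_add \<Rightarrow> 'v) \<Rightarrow> 'v list \<Rightarrow> ('v, 'k) multivector" where
  "decomposable s vs = (\<lambda>\<omega>. if \<omega> \<in> alt_forms s (length vs) then \<omega> vs else 0)"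

text \<open>\<open>ext_power s p U\<close> is \<open>\<Lambda>\<^sup>p U\<close> as a subspace of \<open>\<Lambda>\<^sup>p V\<close>.\<close>

definition ext_power ::
  "('k::field \<Rightarrow> 'v::ab_group_add \<Rightarrow> 'v) \<Rightarrow> nat \<Rightarrow> 'v set \<Rightarrow> ('v, 'k) multivector set" where
  "ext_power s p U = module.span fscale {decomposable s vs | vs. length vs = p \<and> set vs \<subseteq> U}"

text \<open>The formula makes sense for all degrees at once: for \<open>\<xi>\<close> of degree \<open>p\<close> and \<open>\<eta>\<close> of
  degree \<open>q\<close> it only sees forms \<open>\<omega>\<close> of degree \<open>p + q\<close>.\<close>

definition wedge ::
  "('k::field \<Rightarrow> 'v::ab_group_add \<Rightarrow> 'v) \<Rightarrow> ('v, 'k) multivector \<Rightarrow> ('v, 'k) multivector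
     \<Rightarrow> ('v, 'k) multivector"
  where
  "wedge s \<xi> \<eta> = (\<lambda>\<omega>. if \<omega> \<in> (\<Union>n. alt_forms s n)
     then \<xi> (\<lambda>us. \<eta> (\<lambda>vs. \<omega> (us @ vs))) else 0)"

text \<open>Contraction with a linear form \<open>l\<close>: the transpose of \<open>\<omega> \<mapsto> l \<and> \<omega>\<close>.\<close>

definition contract ::
  "('k::field \<Rightarrow> 'v::ab_group_add \<Rightarrow> 'v) \<Rightarrow> ('v \<Rightarrow> 'k) \<Rightarrow> ('v, 'k) multivector
     \<Rightarrow> ('v, 'k) multivector"
  where
  "contract s l \<xi> = (\<lambda>\<omega>. if \<omega> \<in> (\<Union>n. alt_forms s n)
     then \<xi> (\<lambda>vs. \<Sum>i<length vs. (-1) ^ i * l (vs ! i) * \<omega> (take i vs @ drop (Suc i) vs)) else 0)"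


section \<open>Extended Lagrangian data\<close>

text \<open>\<open>L = (V\<^sub>6/V\<^sub>5)\<^sup>\<or>\<close>, as the space of linear forms on \<open>V\<^sub>6\<close> vanishing on \<open>V\<^sub>5\<close>.\<close>

definition L_space :: "('k::field \<Rightarrow> 'v::ab_group_add \<Rightarrow> 'v) \<Rightarrow> 'v set \<Rightarrow> ('v \<Rightarrow> 'k) set" where
  "L_space s V5 = {l. Vector_Spaces.linear s (*) l \<and> (\<forall>v\<in>V5. l v = 0)}"

definition kL_scale :: "'k::field \<Rightarrow> 'k \<times> ('v \<Rightarrow> 'k) \<Rightarrow> 'k \<times> ('v \<Rightarrow> 'k)" where
  "kL_scale c p = (c * fst p, fscale c (snd p))"

definition kL_form :: "'k::field \<times> ('v \<Rightarrow> 'k) \<Rightarrow> 'k \<times> ('v \<Rightarrow> 'k) \<Rightarrow> 'v \<Rightarrow> 'k" where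
  "kL_form p q = fscale (fst p) (snd q) - fscale (fst q) (snd p)"

definition extended_lagrangian_data ::
  "('k::field \<Rightarrow> 'v::ab_group_add \<Rightarrow> 'v) \<Rightarrow> 'v set \<Rightarrow> ('v, 'k) multivector set
     \<Rightarrow> ('k \<times> ('v \<Rightarrow> 'k)) set \<Rightarrow> bool"
  where
  "extended_lagrangian_data s V5 A A1 \<longleftrightarrow>
     vector_space s \<and> vector_space.dim s UNIV = 6 \<and>
     module.subspace s V5 \<and> vector_space.dim s V5 = 5 \<and>
     lagrangian fscale (ext_power s 3 UNIV) (wedge s) A \<and>
     lagrangian kL_scale (UNIV \<times> L_space s V5) kL_form A1"

definition A1_is_zero ::
  "('k::field \<Rightarrow> 'v::ab_group_add \<Rightarrow> 'v) \<Rightarrow> 'v set \<Rightarrow> ('k \<times> ('v \<Rightarrow> 'k)) set \<Rightarrow> bool" where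
  "A1_is_zero s V5 A1 \<longleftrightarrow> A1 = {0} \<times> L_space s V5"

definition A1_is_infinity :: "('k::field \<times> ('v \<Rightarrow> 'k)) set \<Rightarrow> bool" where
  "A1_is_infinity A1 \<longleftrightarrow> A1 = UNIV \<times> {0}"

definition A1_is_one ::
  "('k::field \<Rightarrow> 'v::ab_group_add \<Rightarrow> 'v) \<Rightarrow> 'v set \<Rightarrow> ('k \<times> ('v \<Rightarrow> 'k)) set \<Rightarrow> bool" where
  "A1_is_one s V5 A1 \<longleftrightarrow> \<not> A1_is_zero s V5 A1 \<and> \<not> A1_is_infinity A1"


section \<open>The spaces \<open>W\<close> and the quadratic forms \<open>q(v)\<close>\<close>

text \<open>As \<open>L\<close> is a line, \<open>M \<otimes> L\<^sup>\<or> = Hom(L, M)\<close>, and an element of it is a function on \<open>L\<close>, extended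
  by \<open>0\<close>.  The map \<open>\<lambda>\<^sub>p\<close> sends \<open>\<xi>\<close> to \<open>l \<mapsto> contract l \<xi>\<close>.\<close>

type_synonym ('v, 'k) twisted = "('v \<Rightarrow> 'k) \<Rightarrow> ('v, 'k) multivector"

definition twisted_scale :: "'k::field \<Rightarrow> ('v, 'k) twisted \<Rightarrow> ('v, 'k) twisted" where
  "twisted_scale c a = (\<lambda>l. fscale c (a l))"

definition twisted_ext_power ::
  "('k::field \<Rightarrow> 'v::ab_group_add \<Rightarrow> 'v) \<Rightarrow> 'v set \<Rightarrow> nat \<Rightarrow> ('v, 'k) twisted set" where
  "twisted_ext_power s V5 p =
     {a. linear_on fscale fscale (L_space s V5) a \<and>
         (\<forall>l \<in> L_space s V5. a l \<in> ext_power s p V5) \<and> (\<forall>l. l \<notin> L_space s V5 \<longrightarrow> a l = 0)}"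

definition lam ::
  "('k::field \<Rightarrow> 'v::ab_group_add \<Rightarrow> 'v) \<Rightarrow> 'v set \<Rightarrow> ('v, 'k) multivector \<Rightarrow> ('v, 'k) twisted" where
  "lam s V5 \<xi> = (\<lambda>l. if l \<in> L_space s V5 then contract s l \<xi> else 0)"

definition W0 ::
  "('k::field \<Rightarrow> 'v::ab_group_add \<Rightarrow> 'v) \<Rightarrow> 'v set \<Rightarrow> ('v, 'k) multivector set
     \<Rightarrow> ('v, 'k) twisted set" where
  "W0 s V5 A = lam s V5 ` A"

definition W1 :: "('k::field \<times> ('v \<Rightarrow> 'k)) set \<Rightarrow> 'k set" where
  "W1 A1 = fst ` A1"

definition WX ::
  "('k::field \<Rightarrow> 'v::ab_group_add \<Rightarrow> 'v) \<Rightarrow> 'v set \<Rightarrow> ('v, 'k) multivector set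
     \<Rightarrow> ('k \<times> ('v \<Rightarrow> 'k)) set \<Rightarrow> (('v, 'k) twisted \<times> 'k) set" where
  "WX s V5 A A1 = W0 s V5 A \<times> W1 A1"

definition W_scale :: "'k::field \<Rightarrow> ('v, 'k) twisted \<times> 'k \<Rightarrow> ('v, 'k) twisted \<times> 'k" where
  "W_scale c w = (twisted_scale c (fst w), c * snd w)"

text \<open>For \<open>\<eta> \<in> \<Lambda>\<^sup>3 V\<^sub>5\<close> and \<open>w \<in> \<Lambda>\<^sup>2 V\<^sub>5 \<otimes> L\<^sup>\<or>\<close>, the pairing with values in
  \<open>det(V\<^sub>5) \<otimes> L\<^sup>\<or> = Hom(L, det(V\<^sub>5))\<close> is \<open>l \<mapsto> \<eta> \<and> w(l)\<close>.\<close>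

definition W0_perp ::
  "('k::field \<Rightarrow> 'v::ab_group_add \<Rightarrow> 'v) \<Rightarrow> 'v set \<Rightarrow> ('v, 'k) multivector set
     \<Rightarrow> ('v, 'k) multivector set" where
  "W0_perp s V5 A =
     {\<eta> \<in> ext_power s 3 V5. \<forall>w \<in> W0 s V5 A. \<forall>l \<in> L_space s V5. wedge s \<eta> (w l) = 0}"

definition W1_perp ::
  "('k::field \<Rightarrow> 'v::ab_group_add \<Rightarrow> 'v) \<Rightarrow> 'v set \<Rightarrow> ('k \<times> ('v \<Rightarrow> 'k)) set \<Rightarrow> ('v \<Rightarrow> 'k) set" where
  "W1_perp s V5 A1 = {l \<in> L_space s V5. \<forall>x \<in> W1 A1. kL_form (x, 0) (0, l) = 0}"

text \<open>\<open>L\<^sup>\<otimes>\<^sup>2\<close> as a space of bilinear forms on \<open>V\<^sub>6\<close>.\<close>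

definition L_tensor :: "('v \<Rightarrow> 'k::field) \<Rightarrow> ('v \<Rightarrow> 'k) \<Rightarrow> 'v \<times> 'v \<Rightarrow> 'k" where
  "L_tensor l l' = (\<lambda>(v, w). l v * l' w)"

definition L_square ::
  "('k::field \<Rightarrow> 'v::ab_group_add \<Rightarrow> 'v) \<Rightarrow> 'v set \<Rightarrow> ('v \<times> 'v \<Rightarrow> 'k) set" where
  "L_square s V5 = module.span fscale {L_tensor l l' | l l'. l \<in> L_space s V5 \<and> l' \<in> L_space s V5}"

text \<open>For \<open>\<alpha> \<in> \<Lambda>\<^sup>3 V\<^sub>5 \<otimes> L\<^sup>\<or>\<close> and \<open>\<beta> \<in> \<Lambda>\<^sup>2 V\<^sub>5 \<otimes> L\<^sup>\<or>\<close>, the product \<open>\<alpha> \<and> \<beta>\<close> lies in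
  \<open>det(V\<^sub>5) \<otimes> (L\<^sup>\<or>)\<^sup>\<otimes>\<^sup>2 = Hom(L\<^sup>\<otimes>\<^sup>2, det(V\<^sub>5))\<close> and sends \<open>l \<otimes> l'\<close> to \<open>\<alpha>(l) \<and> \<beta>(l')\<close>.  Composing
  with \<open>\<epsilon> : det(V\<^sub>5) \<rightarrow> L\<^sup>\<otimes>\<^sup>2\<close> gives an endomorphism of the line \<open>L\<^sup>\<otimes>\<^sup>2\<close>, that is, a scalar, and
  this scalar is \<open>\<epsilon>(\<alpha> \<and> \<beta>)\<close>.\<close>

definition eps_pairing ::
  "('k::field \<Rightarrow> 'v::ab_group_add \<Rightarrow> 'v) \<Rightarrow> 'v set \<Rightarrow> (('v, 'k) multivector \<Rightarrow> 'v \<times> 'v \<Rightarrow> 'k)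
     \<Rightarrow> ('v, 'k) twisted \<Rightarrow> ('v, 'k) twisted \<Rightarrow> 'k"
  where
  "eps_pairing s V5 \<epsilon> \<alpha> \<beta> =
     (THE c. \<forall>l \<in> L_space s V5. \<forall>l' \<in> L_space s V5.
        \<epsilon> (wedge s (\<alpha> l) (\<beta> l')) = fscale c (L_tensor l l'))"

definition q0 ::
  "('k::field \<Rightarrow> 'v::ab_group_add \<Rightarrow> 'v) \<Rightarrow> 'v set \<Rightarrow> ('v, 'k) multivector set
     \<Rightarrow> (('v, 'k) multivector \<Rightarrow> 'v \<times> 'v \<Rightarrow> 'k) \<Rightarrow> 'v \<Rightarrow> ('v, 'k) twisted \<Rightarrow> ('v, 'k) twisted \<Rightarrow> 'k"
  where
  "q0 s V5 A \<epsilon> v a b =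
     (THE c. \<exists>\<xi>1 \<in> A. \<exists>\<xi>2 \<in> A. lam s V5 \<xi>1 = a \<and> lam s V5 \<xi>2 = b \<and>
        c = - eps_pairing s V5 \<epsilon> (lam s V5 (wedge s (decomposable s [v]) \<xi>1)) (lam s V5 \<xi>2))"

text \<open>\<open>\<lambda>(v) \<in> L\<^sup>\<or>\<close> is evaluation at \<open>v\<close>, so \<open>\<lambda>(v) x\<^sub>1 x\<^sub>2'\<close> is \<open>x\<^sub>1 * x\<^sub>2' v\<close>.\<close>

definition q1 :: "('k::field \<times> ('v \<Rightarrow> 'k)) set \<Rightarrow> 'v \<Rightarrow> 'k \<Rightarrow> 'k \<Rightarrow> 'k" where
  "q1 A1 v x1 x2 = (THE c. \<exists>x1' x2'. (x1, x1') \<in> A1 \<and> (x2, x2') \<in> A1 \<and> c = x1 * x2' v)"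

definition q ::
  "('k::field \<Rightarrow> 'v::ab_group_add \<Rightarrow> 'v) \<Rightarrow> 'v set \<Rightarrow> ('v, 'k) multivector set
     \<Rightarrow> ('k \<times> ('v \<Rightarrow> 'k)) set \<Rightarrow> (('v, 'k) multivector \<Rightarrow> 'v \<times> 'v \<Rightarrow> 'k)
     \<Rightarrow> 'v \<Rightarrow> ('v, 'k) twisted \<times> 'k \<Rightarrow> ('v, 'k) twisted \<times> 'k \<Rightarrow> 'k"
  where
  "q s V5 A A1 \<epsilon> v w w' = q0 s V5 A \<epsilon> v (fst w) (fst w') + q1 A1 v (snd w) (snd w')"

definition form_kernel :: "'w set \<Rightarrow> ('w \<Rightarrow> 'w \<Rightarrow> 'k::zero) \<Rightarrow> 'w set" where
  "form_kernel W b = {w \<in> W. \<forall>w' \<in> W. b w w' = 0}"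


section \<open>Closed subschemes of \<open>\<P>(W)\<close>\<close>

text \<open>Let \<open>K\<close> be a subfield of the complex numbers containing the image of \<open>\<iota>\<close>.  The homogeneous
  coordinate ring \<open>Sym(W\<^sup>\<or>) \<otimes> K\<close> of \<open>\<P>(W)\<^sub>K\<close> is realised as the \<open>K\<close>-algebra of functions on the
  finite-dimensional \<open>'k\<close>-space \<open>W\<close> generated by \<open>W\<^sup>\<or>\<close>.  This is legitimate because \<open>'k\<close>
  is infinite, so that a polynomial with coefficients in \<open>K\<close> vanishing on all \<open>'k\<close>-points of
  \<open>W\<close> is zero.  Functions are extended by \<open>0\<close> outside \<open>W\<close>.\<close>

definition on_set :: "'w set \<Rightarrow> ('w \<Rightarrow> complex) \<Rightarrow> 'w \<Rightarrow> complex" where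
  "on_set W f = (\<lambda>w. if w \<in> W then f w else 0)"

inductive_set poly_funs ::
  "('k::field \<Rightarrow> complex) \<Rightarrow> ('k \<Rightarrow> 'w::ab_group_add \<Rightarrow> 'w) \<Rightarrow> 'w set \<Rightarrow> complex set
     \<Rightarrow> ('w \<Rightarrow> complex) set"
  for \<iota> sw W K where
  const: "c \<in> K \<Longrightarrow> on_set W (\<lambda>_. c) \<in> poly_funs \<iota> sw W K"
| coord: "linear_on sw (*) W \<phi> \<Longrightarrow> on_set W (\<lambda>w. \<iota> (\<phi> w)) \<in> poly_funs \<iota> sw W K"
| add: "f \<in> poly_funs \<iota> sw W K \<Longrightarrow> g \<in> poly_funs \<iota> sw W K
     \<Longrightarrow> (\<lambda>w. f w + g w) \<in> poly_funs \<iota> sw W K"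
| mult: "f \<in> poly_funs \<iota> sw W K \<Longrightarrow> g \<in> poly_funs \<iota> sw W K
     \<Longrightarrow> (\<lambda>w. f w * g w) \<in> poly_funs \<iota> sw W K"

definition coord_ring ::
  "('k::field \<Rightarrow> complex) \<Rightarrow> ('k \<Rightarrow> 'w::ab_group_add \<Rightarrow> 'w) \<Rightarrow> 'w set \<Rightarrow> complex set
     \<Rightarrow> ('w \<Rightarrow> complex) ring"
  where
  "coord_ring \<iota> sw W K =
     \<lparr>carrier = poly_funs \<iota> sw W K,
      monoid.mult = (\<lambda>f g w. f w * g w), one = on_set W (\<lambda>_. 1),
      zero = (\<lambda>_. 0), add = (\<lambda>f g w. f w + g w)\<rparr>"

definition homog_part ::
  "('k::field \<Rightarrow> complex) \<Rightarrow> ('k \<Rightarrow> 'w::ab_group_add \<Rightarrow> 'w) \<Rightarrow> 'w set \<Rightarrow> complex set \<Rightarrow> nat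
     \<Rightarrow> ('w \<Rightarrow> complex) set"
  where
  "homog_part \<iota> sw W K d =
     {f \<in> poly_funs \<iota> sw W K. \<forall>t. \<forall>w\<in>W. f (sw t w) = \<iota> t ^ d * f w}"

definition homog_ideal ::
  "('k::field \<Rightarrow> complex) \<Rightarrow> ('k \<Rightarrow> 'w::ab_group_add \<Rightarrow> 'w) \<Rightarrow> 'w set \<Rightarrow> complex set
     \<Rightarrow> ('w \<Rightarrow> complex) set \<Rightarrow> bool"
  where
  "homog_ideal \<iota> sw W K I \<longleftrightarrow>
     ideal I (coord_ring \<iota> sw W K) \<and>
     I = genideal (coord_ring \<iota> sw W K) (I \<inter> (\<Union>d. homog_part \<iota> sw W K d))"

text \<open>A closed subscheme of \<open>\<P>(W)\<^sub>K\<close> is represented by its saturated homogeneous ideal.  The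
  scheme defined by a set \<open>F\<close> of homogeneous equations is represented by the saturation of the
  ideal generated by \<open>F\<close>.\<close>

definition closed_subscheme ::
  "('k::field \<Rightarrow> complex) \<Rightarrow> ('k \<Rightarrow> 'w::ab_group_add \<Rightarrow> 'w) \<Rightarrow> 'w set \<Rightarrow> complex set
     \<Rightarrow> ('w \<Rightarrow> complex) set \<Rightarrow> ('w \<Rightarrow> complex) set"
  where
  "closed_subscheme \<iota> sw W K F =
     {f \<in> poly_funs \<iota> sw W K.
        \<exists>n. \<forall>g \<in> homog_part \<iota> sw W K n. (\<lambda>w. g w * f w) \<in> genideal (coord_ring \<iota> sw W K) F}"

text \<open>The points of a closed subscheme \<open>X\<close> are the homogeneous primes containing its ideal but
  not the irrelevant ideal.  Irreducible closed subsets correspond to points, so the dimension is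
  the maximal length of a chain of points (such chains have length at most \<open>dim W - 1\<close>).\<close>

definition scheme_points ::
  "('k::field \<Rightarrow> complex) \<Rightarrow> ('k \<Rightarrow> 'w::ab_group_add \<Rightarrow> 'w) \<Rightarrow> 'w set \<Rightarrow> complex set
     \<Rightarrow> ('w \<Rightarrow> complex) set \<Rightarrow> ('w \<Rightarrow> complex) set set"
  where
  "scheme_points \<iota> sw W K X =
     {P. primeideal P (coord_ring \<iota> sw W K) \<and> homog_ideal \<iota> sw W K P \<and> X \<subseteq> P \<and>
         \<not> (\<forall>d>0. homog_part \<iota> sw W K d \<subseteq> P)}"

definition scheme_dim ::
  "('k::field \<Rightarrow> complex) \<Rightarrow> ('k \<Rightarrow> 'w::ab_group_add \<Rightarrow> 'w) \<Rightarrow> 'w set \<Rightarrow> complex set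
     \<Rightarrow> ('w \<Rightarrow> complex) set \<Rightarrow> nat"
  where
  "scheme_dim \<iota> sw W K X =
     Sup {n. \<exists>P :: nat \<Rightarrow> ('w \<Rightarrow> complex) set.
        (\<forall>i\<le>n. P i \<in> scheme_points \<iota> sw W K X) \<and> (\<forall>i<n. P i \<subset> P (Suc i))}"

text \<open>\<open>X\<close> is integral iff its saturated homogeneous ideal is prime; in particular the ideal is then
  proper and \<open>X\<close> is nonempty.\<close>

definition integral_subscheme ::
  "('k::field \<Rightarrow> complex) \<Rightarrow> ('k \<Rightarrow> 'w::ab_group_add \<Rightarrow> 'w) \<Rightarrow> 'w set \<Rightarrow> complex set
     \<Rightarrow> ('w \<Rightarrow> complex) set \<Rightarrow> bool"
  where
  "integral_subscheme \<iota> sw W K X \<longleftrightarrow> primeideal X (coord_ring \<iota> sw W K)"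

definition complex_subfield :: "complex set \<Rightarrow> bool" where
  "complex_subfield K \<longleftrightarrow> 1 \<in> K \<and>
     (\<forall>x\<in>K. \<forall>y\<in>K. x - y \<in> K \<and> x * y \<in> K) \<and> (\<forall>x\<in>K. inverse x \<in> K)"

text \<open>The base change of \<open>X\<close> to \<open>K\<close> is defined by the same equations.  The field extensions inside
  the complex numbers include an algebraic closure of the base field.\<close>

definition geometrically_integral ::
  "('k::field \<Rightarrow> complex) \<Rightarrow> ('k \<Rightarrow> 'w::ab_group_add \<Rightarrow> 'w) \<Rightarrow> 'w set \<Rightarrow> ('w \<Rightarrow> complex) set \<Rightarrow> bool"
  where
  "geometrically_integral \<iota> sw W X \<longleftrightarrow>
     (\<forall>K. complex_subfield K \<and> range \<iota> \<subseteq> K \<longrightarrow>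
        integral_subscheme \<iota> sw W K (closed_subscheme \<iota> sw W K X))"


section \<open>GM intersections and GM varieties\<close>

text \<open>\<open>W\<close> is a subspace of \<open>(\<Lambda>\<^sup>2 V\<^sub>5 \<otimes> L\<^sup>\<or>) \<oplus> C\<close>, where \<open>sw\<close> is the scalar
  multiplication and \<open>C\<close> is the type \<open>'c\<close>; the twist by the line \<open>L\<^sup>\<or>\<close> does not change
  projective spaces.  The cone over \<open>Gr(2, V\<^sub>5)\<close> with vertex \<open>\<P>(C)\<close> is defined by the Pluecker
  quadrics, that is, by the vanishing of \<open>w\<^sub>0 \<and> w\<^sub>0\<close> for the component \<open>w\<^sub>0\<close> of \<open>w\<close> in
  \<open>\<Lambda>\<^sup>2 V\<^sub>5 \<otimes> L\<^sup>\<or>\<close>; the coordinates of this 4-vector are its values at the alternating forms.\<close>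

definition pluecker_equations ::
  "('k::field \<Rightarrow> complex) \<Rightarrow> ('k \<Rightarrow> 'v::ab_group_add \<Rightarrow> 'v) \<Rightarrow> 'v set
     \<Rightarrow> (('v, 'k) twisted \<times> 'c) set \<Rightarrow> (('v, 'k) twisted \<times> 'c \<Rightarrow> complex) set"
  where
  "pluecker_equations \<iota> s V5 W =
     {on_set W (\<lambda>w. \<iota> (wedge s (fst w l) (fst w l) \<omega>)) | l \<omega>.
        l \<in> L_space s V5 \<and> \<omega> \<in> alt_forms s 4}"

definition gm_intersection ::
  "('k::field \<Rightarrow> complex) \<Rightarrow> ('k \<Rightarrow> 'v::ab_group_add \<Rightarrow> 'v) \<Rightarrow> 'v set
     \<Rightarrow> ('k \<Rightarrow> ('v, 'k) twisted \<times> 'c::ab_group_add \<Rightarrow> ('v, 'k) twisted \<times> 'c)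
     \<Rightarrow> (('v, 'k) twisted \<times> 'c) set \<Rightarrow> (('v, 'k) twisted \<times> 'c \<Rightarrow> complex) set \<Rightarrow> bool"
  where
  "gm_intersection \<iota> s V5 sw W X \<longleftrightarrow>
     module.subspace sw W \<and> W \<subseteq> twisted_ext_power s V5 2 \<times> UNIV \<and>
     (\<exists>Q \<in> homog_part \<iota> sw W (range \<iota>) 2.
        X = closed_subscheme \<iota> sw W (range \<iota>) (pluecker_equations \<iota> s V5 W \<union> {Q}))"

definition gm_variety ::
  "('k::field \<Rightarrow> complex) \<Rightarrow> ('k \<Rightarrow> 'v::ab_group_add \<Rightarrow> 'v) \<Rightarrow> 'v set
     \<Rightarrow> ('k \<Rightarrow> ('v, 'k) twisted \<times> 'c::ab_group_add \<Rightarrow> ('v, 'k) twisted \<times> 'c)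
     \<Rightarrow> (('v, 'k) twisted \<times> 'c) set \<Rightarrow> (('v, 'k) twisted \<times> 'c \<Rightarrow> complex) set \<Rightarrow> bool"
  where
  "gm_variety \<iota> s V5 sw W X \<longleftrightarrow>
     gm_intersection \<iota> s V5 sw W X \<and>
     geometrically_integral \<iota> sw W X \<and>
     int (scheme_dim \<iota> sw W (range \<iota>) X) = int (vector_space.dim sw W) - 5 \<and>
     scheme_dim \<iota> sw W (range \<iota>) X \<ge> 1"

text \<open>The intersection of the quadrics \<open>q(v) = 0\<close>, \<open>v \<in> V\<^sub>6\<close>, in \<open>\<P>(W)\<close>.\<close>

definition X_scheme ::
  "('k::field \<Rightarrow> complex) \<Rightarrow> ('k \<Rightarrow> 'v::ab_group_add \<Rightarrow> 'v) \<Rightarrow> 'v set \<Rightarrow> ('v, 'k) multivector set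
     \<Rightarrow> ('k \<times> ('v \<Rightarrow> 'k)) set \<Rightarrow> (('v, 'k) multivector \<Rightarrow> 'v \<times> 'v \<Rightarrow> 'k)
     \<Rightarrow> (('v, 'k) twisted \<times> 'k \<Rightarrow> complex) set"
  where
  "X_scheme \<iota> s V5 A A1 \<epsilon> =
     closed_subscheme \<iota> W_scale (WX s V5 A A1) (range \<iota>)
       {on_set (WX s V5 A A1) (\<lambda>w. \<iota> (q s V5 A A1 \<epsilon> v w w)) | v. True}"

end

theory Submission
  imports Defs "HOL-Library.Multiset"
begin

text \<open>
  Contraction with a generator \<open>l\<close> of \<open>L\<close> is injective on \<open>\<Lambda>\<^sup>6 V\<^sub>6\<close>, and for \<open>\<eta> \<in> \<Lambda>\<^sup>3 V\<^sub>5\<close> it turns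
  \<open>\<eta> \<and> \<xi>\<close> into \<open>\<plusminus> \<eta> \<and> \<lambda>\<^sub>3(\<xi>)\<close>.  Hence \<open>\<eta>\<close> annihilates \<open>W(X)\<^sub>0 = \<lambda>\<^sub>3(A)\<close> iff \<open>\<eta> \<and> A = 0\<close>, that is, iff
  \<open>\<eta> \<in> A\<close>, since \<open>A\<close> is Lagrangian; this is (a).  For \<open>v \<notin> V\<^sub>5\<close> write \<open>\<xi> \<in> A\<close> as \<open>\<xi> = \<alpha> + v \<and> \<beta>\<close> over
  \<open>V\<^sub>5\<close>.  Then \<open>q\<^sub>0(v)(\<lambda>\<^sub>3(\<xi>\<^sub>1), \<lambda>\<^sub>3(\<xi>\<^sub>2)) = -\<epsilon>(\<alpha>\<^sub>1 \<and> \<beta>\<^sub>2)\<close>, so \<open>\<lambda>\<^sub>3(\<xi>\<^sub>1)\<close> is in the kernel iff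
  \<open>\<alpha>\<^sub>1 \<in> W(X)\<^sub>0\<^sup>\<bottom> = A \<inter> \<Lambda>\<^sup>3 V\<^sub>5\<close>, iff \<open>v \<and> \<beta>\<^sub>1 \<in> A\<close>; the form \<open>q\<^sub>1(v)\<close> is nondegenerate because
  \<open>A\<^sub>1 \<noteq> \<infinity>\<close>.  For (c), the perfect pairing of \<open>\<Lambda>\<^sup>2 V\<^sub>5\<close> and \<open>\<Lambda>\<^sup>3 V\<^sub>5\<close> gives
  \<open>dim W(X)\<^sub>0 + dim (A \<inter> \<Lambda>\<^sup>3 V\<^sub>5) = 10\<close>, and a GM variety has dimension \<open>dim W(X) - 5\<close>.
\<close>

section \<open>Linear algebra\<close>

global_interpretation fs: vector_space "fscale :: 'k::field \<Rightarrow> ('x \<Rightarrow> 'k) \<Rightarrow> 'x \<Rightarrow> 'k"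
  by unfold_locales (simp_all add: fscale_def fun_eq_iff algebra_simps)

lemma fscale_apply: "fscale c f x = c * f x"
  by (simp add: fscale_def)

lemmas fun_simps = plus_fun_apply zero_fun_apply minus_apply uminus_apply fscale_apply

declare plus_fun_apply [simp del] zero_fun_apply [simp del] minus_apply [simp del] uminus_apply [simp del]
  \<comment> \<open>otherwise multivectors are rewritten inside eta-expanded terms\<close>

global_interpretation tw: vector_space
  "twisted_scale :: 'k::field \<Rightarrow> ('v, 'k) twisted \<Rightarrow> ('v, 'k) twisted"
  by unfold_locales
    (simp_all add: twisted_scale_def fun_eq_iff fun_simps algebra_simps)

global_interpretation Wv: vector_space
  "W_scale :: 'k::field \<Rightarrow> ('v, 'k) twisted \<times> 'k \<Rightarrow> ('v, 'k) twisted \<times> 'k"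
  by unfold_locales
    (simp_all add: W_scale_def prod_eq_iff algebra_simps)

global_interpretation kL: vector_space
  "kL_scale :: 'k::field \<Rightarrow> 'k \<times> ('v \<Rightarrow> 'k) \<Rightarrow> 'k \<times> ('v \<Rightarrow> 'k)"
  by unfold_locales
    (simp_all add: kL_scale_def prod_eq_iff algebra_simps)

lemma vector_space_field: "vector_space ((*) :: 'k::field \<Rightarrow> 'k \<Rightarrow> 'k)"
  by unfold_locales (simp_all add: algebra_simps)

lemma (in vector_space_pair) dim_image_inj:
  assumes f: "Vector_Spaces.linear s1 s2 f" and U: "vs1.subspace U" and inj: "inj_on f U"
  shows "vs2.dim (f ` U) = vs1.dim U"
proof -
  obtain B where B: "B \<subseteq> U" "vs1.independent B" "U \<subseteq> vs1.span B" "card B = vs1.dim U"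
    using vs1.basis_exists by blast
  then have span: "vs1.span B = U"
    using U vs1.span_minimal by blast
  then have "vs2.independent (f ` B)"
    using linear_independent_injective_image[OF f B(2)] inj by simp
  moreover have "vs2.span (f ` B) = f ` U"
    using linear_span_image[OF f, of B] span by simp
  moreover have "card (f ` B) = card B"
    using inj B(1) by (meson card_image inj_on_subset)
  ultimately show ?thesis
    using B(4) vs2.dim_span_eq_card_independent by metis
qed

section \<open>Dual systems and annihilators, for maps linear on a subspace\<close>

lemma linear_on_zero:
  assumes "vector_space sa" "vector_space sb" "linear_on sa sb E f" "0 \<in> E"
  shows "f 0 = 0"
proof -
  interpret va: vector_space sa by fact
  interpret vb: vector_space sb by fact
  show ?thesis
    using assms(3,4) unfolding linear_on_def by (metis va.scale_zero_left vb.scale_zero_left)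
qed

lemma linear_on_sum:
  assumes "vector_space sa" "vector_space sb" "linear_on sa sb E f" "module.subspace sa E"
    and "\<And>i. i \<in> I \<Longrightarrow> b i \<in> E"
  shows "f (\<Sum>i\<in>I. sa (c i) (b i)) = (\<Sum>i\<in>I. sb (c i) (f (b i)))"
proof -
  interpret va: vector_space sa by fact
  interpret vb: vector_space sb by fact
  have f0: "f 0 = 0"
    using linear_on_zero[OF assms(1-3)] va.subspace_0[OF assms(4)] by blast
  show ?thesis
    using assms(5)
  proof (induction I rule: infinite_finite_induct)
    case (insert i I)
    then have "(\<Sum>i\<in>I. sa (c i) (b i)) \<in> E" "sa (c i) (b i) \<in> E"
      by (auto intro!: va.subspace_sum va.subspace_scale assms(4))
    with insert assms(3) show ?case
      unfolding linear_on_def by simp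
  qed (auto simp: f0)
qed

text \<open>Applying \<open>\<phi> j\<close> to a vanishing combination isolates its j-th
  coefficient. Linearity is asked on \<open>E\<close> only, since the spaces in question are
  subspaces of large function types.\<close>

lemma independent_dual:
  fixes sa :: "'k::field \<Rightarrow> 'a::ab_group_add \<Rightarrow> 'a"
  assumes "vector_space sa" "module.subspace sa E" "finite I"
    and "\<And>i. i \<in> I \<Longrightarrow> b i \<in> E" "\<And>i. i \<in> I \<Longrightarrow> linear_on sa (*) E (\<phi> i)"
    and dual: "\<And>i j. i \<in> I \<Longrightarrow> j \<in> I \<Longrightarrow> \<phi> j (b i) = (if i = j then 1 else 0)"
  shows "inj_on b I \<and> \<not> module.dependent sa (b ` I)"
proof
  interpret va: vector_space sa by fact
  show inj: "inj_on b I"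
    using dual by (metis inj_onI zero_neq_one)
  show "\<not> va.dependent (b ` I)"
  proof (rule va.independent_if_scalars_zero)
    fix u x assume 0: "(\<Sum>x\<in>b ` I. sa (u x) x) = 0" and "x \<in> b ` I"
    then obtain j where j: "j \<in> I" "x = b j"
      by auto
    have "0 = \<phi> j (\<Sum>i\<in>I. sa (u (b i)) (b i))"
      using 0 inj linear_on_zero[OF assms(1) vector_space_field assms(5)[OF j(1)]] va.subspace_0[OF assms(2)]
      by (simp add: sum.reindex)
    also have "\<dots> = (\<Sum>i\<in>I. u (b i) * \<phi> j (b i))"
      using assms(4) by (intro linear_on_sum[OF assms(1) vector_space_field assms(5)[OF j(1)] assms(2)])
    also have "\<dots> = (\<Sum>i\<in>I. if i = j then u (b i) else 0)"
      using dual j by (intro sum.cong) auto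
    finally show "u x = 0"
      using j assms(3) by simp
  qed (use assms(3) in simp)
qed

text \<open>Both sides are linear in \<open>x\<close> and agree on the generators
  \<open>b j\<close>, so induction along the span suffices.\<close>

lemma dual_expansion:
  fixes sa :: "'k::field \<Rightarrow> 'a::ab_group_add \<Rightarrow> 'a"
  assumes va: "vector_space sa" and I: "finite I" and E: "E = module.span sa (b ` I)"
    and \<phi>: "\<And>i. i \<in> I \<Longrightarrow> linear_on sa (*) E (\<phi> i)"
    and dual: "\<And>i j. i \<in> I \<Longrightarrow> j \<in> I \<Longrightarrow> \<phi> j (b i) = (if i = j then 1 else 0)"
    and x: "x \<in> E"
  shows "x = (\<Sum>i\<in>I. sa (\<phi> i x) (b i))"
proof -
  interpret va: vector_space sa by fact
  have "x \<in> va.span (b ` I)"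
    using x E by simp
  then show ?thesis
  proof (induction rule: va.span_induct_alt)
    case base
    show ?case
      using linear_on_zero[OF va vector_space_field \<phi>] va.span_zero by (simp add: E)
  next
    case (step c x y)
    then obtain j where j: "j \<in> I" "x = b j"
      by auto
    have "(\<Sum>i\<in>I. sa (\<phi> i y) (b i)) \<in> E"
      unfolding E by (intro va.span_sum va.span_scale va.span_base imageI)
    then have E': "x \<in> E" "sa c x \<in> E" "y \<in> E"
      using j step unfolding E by (auto intro: va.span_base va.span_scale)
    have "\<phi> i (sa c x + y) = (if i = j then c else 0) + \<phi> i y" if "i \<in> I" for i
    proof -
      have "\<phi> i (sa c x + y) = \<phi> i (sa c x) + \<phi> i y" "\<phi> i (sa c x) = c * \<phi> i x"
        using \<phi>[OF that] E' unfolding linear_on_def by blast+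
      then show ?thesis
        using dual[OF j(1) that] j(2) by auto
    qed
    then have "(\<Sum>i\<in>I. sa (\<phi> i (sa c x + y)) (b i)) =
        (\<Sum>i\<in>I. (if i = j then sa c (b i) else 0) + sa (\<phi> i y) (b i))"
      by (intro sum.cong refl) (auto simp: va.scale_left_distrib)
    also have "\<dots> = sa c x + (\<Sum>i\<in>I. sa (\<phi> i y) (b i))"
      using j I by (simp add: sum.distrib)
    finally show ?case
      using step by simp
  qed
qed

text \<open>A basis \<open>C\<close> of \<open>U\<close> is extended to a basis \<open>C'\<close> of
  \<open>E\<close>; the elements of \<open>F\<close> representing the coordinates at
  \<open>C' - C\<close> form a basis of the annihilator.\<close>

lemma dim_annihilator:
  fixes sa :: "'k::field \<Rightarrow> 'a::ab_group_add \<Rightarrow> 'a" and sb :: "'k \<Rightarrow> 'b::ab_group_add \<Rightarrow> 'b"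
  assumes va: "vector_space sa" and vb: "vector_space sb" and I: "finite I"
    and E: "E = module.span sa (b ` I)" and F: "F = module.span sb (d ` I)"
    and pE: "\<And>\<eta>. \<eta> \<in> F \<Longrightarrow> linear_on sa (*) E (p \<eta>)"
    and pF: "\<And>\<beta>. \<beta> \<in> E \<Longrightarrow> linear_on sb (*) F (\<lambda>\<eta>. p \<eta> \<beta>)"
    and dual: "\<And>i j. i \<in> I \<Longrightarrow> j \<in> I \<Longrightarrow> p (d j) (b i) = (if i = j then 1 else 0)"
    and U: "module.subspace sa U" "U \<subseteq> E"
  shows "vector_space.dim sa U + vector_space.dim sb {\<eta> \<in> F. \<forall>\<beta>\<in>U. p \<eta> \<beta> = 0} = card I"
proof -
  interpret va: vector_space sa by fact
  interpret vb: vector_space sb by fact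
  have subE: "va.subspace E" and subF: "vb.subspace F"
    unfolding E F by (rule va.subspace_span vb.subspace_span)+
  have bE: "b i \<in> E" and dF: "d i \<in> F" if "i \<in> I" for i
    using that unfolding E F by (auto intro: va.span_base vb.span_base)
  note sumE = linear_on_sum[OF va vector_space_field pE subE]
  note sumF = linear_on_sum[OF vb vector_space_field pF subF]
  have expE: "\<beta> = (\<Sum>i\<in>I. sa (p (d i) \<beta>) (b i))" if "\<beta> \<in> E" for \<beta>
    using dual_expansion[OF va I E, of "\<lambda>i. p (d i)"] that pE dF dual by blast
  have expF: "\<eta> = (\<Sum>i\<in>I. sb (p \<eta> (b i)) (d i))" if "\<eta> \<in> F" for \<eta>
    by (rule dual_expansion[OF vb I F, of "\<lambda>i \<eta>. p \<eta> (b i)"]) (use that pF bE dual in auto)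
  have "inj_on b I \<and> \<not> va.dependent (b ` I)"
    using bE pE dF dual by (intro independent_dual[OF va subE I, where \<phi> = "\<lambda>i. p (d i)"]) auto
  then have dimE: "va.dim E = card I"
    unfolding E va.dim_span by (metis card_image va.dim_eq_card_independent)
  obtain C where C: "C \<subseteq> U" "va.independent C" "U \<subseteq> va.span C" "card C = va.dim U"
    by (rule va.basis_exists)
  obtain C' where C': "C \<subseteq> C'" "C' \<subseteq> E" "va.independent C'" "E \<subseteq> va.span C'"
    using va.maximal_independent_subset_extend[OF order_trans[OF C(1) U(2)] C(2)] by metis
  have finC': "finite C'"
    using va.independent_span_bound[of "b ` I" C'] C' I unfolding E by auto
  have cardC': "card C' = card I"
    using va.basis_card_eq_dim[OF C'(2,4,3)] dimE by simp
  have spanC': "va.span C' = E"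
    using C' subE va.span_minimal by blast
  define f where "f c \<beta> = va.representation C' \<beta> c" for c \<beta>
  have linf: "linear_on sa (*) E (f c)" for c
    unfolding linear_on_def f_def
    using va.representation_add[OF C'(3)] va.representation_scale[OF C'(3)] spanC' by auto
  \<comment> \<open>As \<open>d\<close> is dual to \<open>b\<close>, these coefficients make
    \<open>\<eta> c\<close> the element of \<open>F\<close> that represents the coordinate
    functional \<open>f c\<close>.\<close>
  define \<eta> where "\<eta> c = (\<Sum>i\<in>I. sb (f c (b i)) (d i))" for c
  have \<eta>F: "\<eta> c \<in> F" for c
    unfolding \<eta>_def using dF by (intro vb.subspace_sum[OF subF] vb.subspace_scale[OF subF])
  have p\<eta>: "p (\<eta> c) \<beta> = f c \<beta>" if "\<beta> \<in> E" for c \<beta>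
  proof -
    have "p (\<eta> c) \<beta> = (\<Sum>i\<in>I. f c (b i) * p (d i) \<beta>)"
      unfolding \<eta>_def using that dF by (rule sumF)
    also have "\<dots> = f c (\<Sum>i\<in>I. sa (p (d i) \<beta>) (b i))"
      using bE linear_on_sum[OF va vector_space_field linf subE, of I b c "\<lambda>i. p (d i) \<beta>"]
      by (simp add: mult.commute)
    finally show ?thesis
      using expE[OF that] by simp
  qed
  have p\<eta>C': "p (\<eta> c') c = (if c = c' then 1 else 0)" if "c \<in> C'" for c c'
    using that C' p\<eta>[of c] va.representation_basis[OF C'(3) that] by (auto simp: f_def)
  let ?N = "{\<eta> \<in> F. \<forall>\<beta>\<in>U. p \<eta> \<beta> = 0}"
  have "\<eta> ` (C' - C) \<subseteq> ?N"
  proof safe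
    fix c \<beta> assume c: "c \<in> C'" "c \<notin> C" and "\<beta> \<in> U"
    have "va.subspace {\<beta> \<in> E. p (\<eta> c) \<beta> = 0}"
      unfolding va.subspace_def using subE pE[OF \<eta>F] linear_on_zero[OF va vector_space_field pE[OF \<eta>F]]
      by (auto simp: va.subspace_def linear_on_def)
    moreover have "C \<subseteq> {\<beta> \<in> E. p (\<eta> c) \<beta> = 0}"
      using C' p\<eta>C' c by auto
    ultimately have "va.span C \<subseteq> {\<beta> \<in> E. p (\<eta> c) \<beta> = 0}"
      by (intro va.span_minimal)
    then show "p (\<eta> c) \<beta> = 0"
      using C(3) \<open>\<beta> \<in> U\<close> by auto
  qed (rule \<eta>F)
  moreover have "?N \<subseteq> vb.span (\<eta> ` (C' - C))"
  proof
    fix \<zeta> assume \<zeta>: "\<zeta> \<in> ?N"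
    \<comment> \<open>Expansion in the elements of \<open>F\<close> dual to \<open>C'\<close>; the
      terms with \<open>c \<in> C\<close> drop out below because \<open>\<zeta>\<close> kills
      \<open>U\<close>.\<close>
    let ?X = "\<Sum>c\<in>C'. sb (p \<zeta> c) (\<eta> c)"
    have XF: "?X \<in> F"
      using \<eta>F by (intro vb.subspace_sum[OF subF] vb.subspace_scale[OF subF])
    have "p ?X (b i) = p \<zeta> (b i)" if i: "i \<in> I" for i
    proof -
      have "p ?X (b i) = (\<Sum>c\<in>C'. p \<zeta> c * p (\<eta> c) (b i))"
        using bE[OF i] \<eta>F by (rule sumF)
      also have "\<dots> = (\<Sum>c\<in>C'. f c (b i) * p \<zeta> c)"
        using p\<eta> bE[OF i] by (simp add: mult.commute)
      also have "\<dots> = p \<zeta> (\<Sum>c\<in>C'. sa (f c (b i)) c)"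
        using sumE[of \<zeta> C' "\<lambda>c. c"] \<zeta> C'(2) by (auto simp: subset_iff)
      also have "(\<Sum>c\<in>C'. sa (f c (b i)) c) = b i"
        unfolding f_def using va.sum_representation_eq[OF C'(3) _ finC' subset_refl] spanC' bE[OF i] by blast
      finally show ?thesis .
    qed
    then have "\<zeta> = ?X"
      using expF[OF XF] expF[of \<zeta>] \<zeta> by simp
    also have "\<dots> = (\<Sum>c\<in>C' - C. sb (p \<zeta> c) (\<eta> c))"
      using \<zeta> C(1) finC' by (intro sum.mono_neutral_right) auto
    also have "\<dots> \<in> vb.span (\<eta> ` (C' - C))"
      by (intro vb.span_sum vb.span_scale vb.span_base) auto
    finally show "\<zeta> \<in> vb.span (\<eta> ` (C' - C))" .
  qed
  moreover have "inj_on \<eta> (C' - C) \<and> \<not> vb.dependent (\<eta> ` (C' - C))"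
    using C'(2) pF p\<eta>C' \<eta>F finC'
    by (intro independent_dual[OF vb subF, where \<phi> = "\<lambda>c \<eta>. p \<eta> c"]) auto
  ultimately have "vb.dim ?N = card (C' - C)"
    using vb.dim_unique[of "\<eta> ` (C' - C)" ?N] by (auto simp: card_image)
  then show ?thesis
    using C(4) C'(1) cardC' finC' card_mono[OF finC' C'(1)]
    by (simp add: card_Diff_subset finite_subset)
qed

text \<open>This is the first isomorphism theorem: \<open>coset_eq\<close> shows that cosets of the
  kernel and values of \<open>f\<close> determine each other.\<close>

lemma induces_quotient_isoI:
  assumes "vector_space sa" and U: "module.subspace sa U" and f: "linear_on sa sb U f"
    and N: "N = {x \<in> U. f x = 0}" and U': "U' = f ` U"
  shows "induces_quotient_iso sa sb f U N U'"
proof -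
  interpret va: vector_space sa by fact
  have add: "f (x + y) = f x + f y" if "x \<in> U" "y \<in> U" for x y
    using f that by (auto simp: linear_on_def)
  have "0 \<in> U"
    using U by (rule va.subspace_0)
  then have "f 0 = 0"
    using add[of 0 0] by simp
  have coset_eq: "coset N x = coset N y \<longleftrightarrow> f x = f y" if xy: "x \<in> U" "y \<in> U" for x y
  proof
    assume "coset N x = coset N y"
    moreover have "x \<in> coset N x"
      using \<open>0 \<in> U\<close> \<open>f 0 = 0\<close> N by (auto simp: coset_def image_iff intro: bexI[of _ 0])
    ultimately show "f x = f y"
      using add xy N by (auto simp: coset_def)
  next
    assume eq: "f x = f y"
    have "f (y - x) = 0" if "x \<in> U" "y \<in> U" "f x = f y" for x y
      using add[of x "y - x"] va.subspace_diff[OF U] that by simp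
    moreover have "coset N x \<subseteq> coset N y" if xy: "x \<in> U" "y \<in> U" "f x = f y" "f (x - y) = 0" for x y
    proof
      fix z assume "z \<in> coset N x"
      then obtain b where b: "b \<in> U" "f b = 0" "z = x + b"
        using N by (auto simp: coset_def)
      have "x - y \<in> U"
        using va.subspace_diff[OF U] xy by blast
      then have "(x - y) + b \<in> N"
        using N b add[of "x - y" b] xy va.subspace_add[OF U] by simp
      then show "z \<in> coset N y"
        using b by (auto simp: coset_def image_iff intro!: bexI[of _ "(x - y) + b"])
    qed
    ultimately show "coset N x = coset N y"
      using xy eq by (intro equalityI) simp_all
  qed
  \<comment> \<open>A coset is only a set, so \<open>g\<close> evaluates \<open>f\<close> at a
    chosen representative; \<open>coset_eq\<close> makes the choice irrelevant.\<close>
  define g where "g C = f (SOME x. x \<in> U \<and> coset N x = C)" for C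
  have g: "g (coset N x) = f x" if "x \<in> U" for x
  proof -
    have "(SOME y. y \<in> U \<and> coset N y = coset N x) \<in> U \<and>
        coset N (SOME y. y \<in> U \<and> coset N y = coset N x) = coset N x"
      using that by (intro someI[of "\<lambda>y. y \<in> U \<and> coset N y = coset N x" x]) simp
    then show ?thesis
      unfolding g_def using coset_eq that by blast
  qed
  moreover have "bij_betw g (quot_space U N) U'"
    unfolding bij_betw_def quot_space_def U'
    using g coset_eq by (auto simp: inj_on_def image_image)
  ultimately show ?thesis
    unfolding induces_quotient_iso_def
    using f va.subspace_add[OF U] va.subspace_scale[OF U]
    by (intro exI[of _ g]) (simp add: linear_on_def)
qed

section \<open>Dimension of \<open>W(X)\<close> as a product\<close>

lemma dim_times_zero:
  fixes U :: "('v, 'k::field) twisted set"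
  assumes "tw.subspace U"
  shows "Wv.dim (U \<times> {0}) = tw.dim U"
proof -
  interpret vector_space_pair "twisted_scale :: 'k \<Rightarrow> ('v, 'k) twisted \<Rightarrow> _" W_scale
    by unfold_locales
  have "Vector_Spaces.linear twisted_scale W_scale (\<lambda>t :: ('v, 'k) twisted. (t, 0 :: 'k))"
    unfolding Vector_Spaces.linear_iff
    using Wv.vector_space_axioms tw.vector_space_axioms by (auto simp: W_scale_def)
  then have "Wv.dim ((\<lambda>t. (t, 0 :: 'k)) ` U) = tw.dim U"
    using assms by (rule dim_image_inj) (auto simp: inj_on_def)
  moreover have "(\<lambda>t. (t, 0 :: 'k)) ` U = U \<times> {0}"
    by auto
  ultimately show ?thesis
    by simp
qed

text \<open>Adding \<open>(0, 1)\<close> to a basis of \<open>U \<times> {0}\<close> gives a basis.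
  Finiteness matters: an infinite basis has \<open>card\<close> 0, and the count would not grow by
  one.\<close>

lemma dim_times_UNIV:
  fixes U :: "('v, 'k::field) twisted set"
  assumes U: "tw.subspace U" and fin: "\<exists>S. finite S \<and> U \<subseteq> tw.span S"
  shows "Wv.dim (U \<times> UNIV) = tw.dim U + 1"
proof -
  interpret vector_space_pair "twisted_scale :: 'k \<Rightarrow> ('v, 'k) twisted \<Rightarrow> _" W_scale
    by unfold_locales
  let ?i = "\<lambda>t :: ('v, 'k) twisted. (t, 0 :: 'k)"
  have i: "Vector_Spaces.linear twisted_scale W_scale ?i"
    unfolding Vector_Spaces.linear_iff
    using Wv.vector_space_axioms tw.vector_space_axioms by (auto simp: W_scale_def)
  obtain C where C: "C \<subseteq> U" "tw.independent C" "U \<subseteq> tw.span C" "card C = tw.dim U"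
    by (rule tw.basis_exists)
  have "finite C"
    using fin C tw.independent_span_bound by (metis order_trans)
  have span: "Wv.span (?i ` C) = U \<times> {0}"
  proof -
    have "tw.span C = U"
      using C U tw.span_minimal by blast
    then show ?thesis
      using linear_span_image[OF i, of C] by auto
  qed
  have "Wv.independent (?i ` C)"
    using linear_independent_injective_image[OF i C(2)] by (simp add: inj_on_def)
  then have "Wv.independent (insert (0, 1) (?i ` C))"
    using span by (simp add: Wv.independent_insert)
  moreover have "U \<times> UNIV \<subseteq> Wv.span (insert (0, 1) (?i ` C))"
  proof
    fix w :: "('v, 'k) twisted \<times> 'k" assume "w \<in> U \<times> UNIV"
    then have "w - W_scale (snd w) (0, 1) \<in> Wv.span (?i ` C)"
      unfolding span by (auto simp: W_scale_def)
    then show "w \<in> Wv.span (insert (0, 1) (?i ` C))"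
      by (auto simp: Wv.span_insert)
  qed
  moreover have "insert (0, 1) (?i ` C) \<subseteq> U \<times> UNIV"
    using C(1) tw.subspace_0[OF U] by auto
  moreover have "card (insert (0, 1) (?i ` C)) = card C + 1"
    using \<open>finite C\<close> by (auto simp: card_image inj_on_def card_insert_if)
  ultimately show ?thesis
    using Wv.dim_unique C(4) by metis
qed

text \<open>Fixes an ordering of every subset of a basis, so that basis p-vectors can be indexed by
  subsets instead of increasing tuples.\<close>

lemma enumerate_subsets:
  assumes "finite B"
  shows "\<exists>ls. \<forall>S. S \<subseteq> B \<longrightarrow> distinct (ls S) \<and> set (ls S) = S"
proof (rule choice, rule allI)
  fix S
  show "\<exists>xs. S \<subseteq> B \<longrightarrow> distinct xs \<and> set xs = S"
    using assms finite_distinct_list[of S] finite_subset[of S B] by auto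
qed

section \<open>Exterior powers\<close>

locale exterior = vector_space s for s :: "'k::field \<Rightarrow> 'v::ab_group_add \<Rightarrow> 'v"
begin

abbreviation "alt \<equiv> alt_forms s"
abbreviation "dec \<equiv> decomposable s"
abbreviation "ext \<equiv> ext_power s"
abbreviation "wdg \<equiv> wedge s"

section \<open>Alternating forms as functions on lists\<close>

lemma linear_functional_iff:
  "Vector_Spaces.linear s (*) f \<longleftrightarrow> (\<forall>x y. f (x + y) = f x + f y) \<and> (\<forall>c x. f (s c x) = c * f x)"
  using vector_space_axioms vector_space_field by (auto simp: Vector_Spaces.linear_iff)

text \<open>Split lists replace list updates. Length conditions disappear because in the wrong
  length both sides of each equation are 0.\<close>

lemma alt_forms_iff:
  "\<omega> \<in> alt p \<longleftrightarrow>
     (\<forall>vs. length vs \<noteq> p \<longrightarrow> \<omega> vs = 0) \<and>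
     (\<forall>as x y bs. \<omega> (as @ (x + y) # bs) = \<omega> (as @ x # bs) + \<omega> (as @ y # bs)) \<and>
     (\<forall>as c x bs. \<omega> (as @ s c x # bs) = c * \<omega> (as @ x # bs)) \<and>
     (\<forall>as x ms bs. \<omega> (as @ x # ms @ x # bs) = 0)" (is "_ \<longleftrightarrow> ?L \<and> ?A \<and> ?S \<and> ?R")
proof
  assume \<omega>: "\<omega> \<in> alt p"
  then have L: ?L
    by (auto simp: alt_forms_def)
  have lin: "Vector_Spaces.linear s (*) (\<lambda>x. \<omega> (as @ x # bs))" for as bs
  proof (cases "length as + length bs + 1 = p")
    case True
    with \<omega> have "Vector_Spaces.linear s (*) (\<lambda>x. \<omega> ((as @ 0 # bs)[length as := x]))"
      unfolding alt_forms_def by (auto simp del: list_update_append list_update_length)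
    then show ?thesis
      by simp
  next
    case False
    then show ?thesis
      using L by (auto simp: linear_functional_iff)
  qed
  moreover have ?R
  proof (intro allI)
    fix as bs ms :: "'v list" and x
    have "\<not> distinct (as @ x # ms @ x # bs)"
      by simp
    then show "\<omega> (as @ x # ms @ x # bs) = 0"
      using \<omega> unfolding alt_forms_def by blast
  qed
  ultimately show "?L \<and> ?A \<and> ?S \<and> ?R"
    using L by (auto simp: linear_functional_iff)
next
  assume *: "?L \<and> ?A \<and> ?S \<and> ?R"
  have "\<omega> vs = 0" if "\<not> distinct vs" for vs
    using not_distinct_decomp[OF that] * by auto
  with * show "\<omega> \<in> alt p"
    by (auto simp: alt_forms_def linear_functional_iff upd_conv_take_nth_drop)
qed

lemma alt_length: "\<omega> \<in> alt p \<Longrightarrow> length vs \<noteq> p \<Longrightarrow> \<omega> vs = 0"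
  and alt_add: "\<omega> \<in> alt p \<Longrightarrow> \<omega> (as @ (x + y) # bs) = \<omega> (as @ x # bs) + \<omega> (as @ y # bs)"
  and alt_scale: "\<omega> \<in> alt p \<Longrightarrow> \<omega> (as @ s c x # bs) = c * \<omega> (as @ x # bs)"
  and alt_repeat: "\<omega> \<in> alt p \<Longrightarrow> \<omega> (as @ x # ms @ x # bs) = 0"
  by (auto simp: alt_forms_iff)

text \<open>Expand the vanishing value at two adjacent copies of \<open>x + y\<close>.\<close>

lemma alt_swap:
  assumes "\<omega> \<in> alt p"
  shows "\<omega> (as @ x # y # bs) = - \<omega> (as @ y # x # bs)"
proof -
  have "0 = \<omega> (as @ (x + y) # [] @ (x + y) # bs)"
    by (simp only: alt_repeat[OF assms])
  also have "\<dots> = \<omega> (as @ x # y # bs) + \<omega> (as @ y # x # bs)"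
    using alt_add[OF assms, of as x y "(x + y) # bs"]
      alt_add[OF assms, of "as @ [x]" x y bs] alt_add[OF assms, of "as @ [y]" x y bs]
      alt_repeat[OF assms, of as x "[]" bs] alt_repeat[OF assms, of as y "[]" bs]
    by simp
  finally show ?thesis
    by (simp add: eq_neg_iff_add_eq_0)
qed

lemma alt_shift:
  assumes "\<omega> \<in> alt p"
  shows "\<omega> (as @ x # ms @ bs) = (- 1) ^ length ms * \<omega> (as @ ms @ x # bs)"
proof (induction ms arbitrary: as)
  case (Cons m ms)
  show ?case
    using alt_swap[OF assms, of as x m "ms @ bs"] Cons.IH[of "as @ [m]"] by simp
qed simp

lemma subspace_alt: "fs.subspace (alt p)"
  by (auto simp: fs.subspace_def alt_forms_iff fun_simps algebra_simps)

text \<open>If \<open>vs\<close> is longer than \<open>n\<close>, the subtraction truncates to 0,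
  but then the slice is identically zero and still a form of that degree.\<close>

lemma alt_append_right:
  assumes "\<omega> \<in> alt n"
  shows "(\<lambda>us. \<omega> (us @ vs)) \<in> alt (n - length vs)"
proof -
  have "\<omega> (us @ vs) = 0" if "length us \<noteq> n - length vs" for us
    using that by (intro alt_length[OF assms]) auto
  then show ?thesis
    using alt_add[OF assms] alt_scale[OF assms] alt_repeat[OF assms]
    unfolding alt_forms_iff by simp
qed

lemma alt_append_left:
  assumes "\<omega> \<in> alt n" "length us \<le> n"
  shows "(\<lambda>vs. \<omega> (us @ vs)) \<in> alt (n - length us)"
proof -
  have "\<omega> (us @ vs) = 0" if "length vs \<noteq> n - length us" for vs
    using that assms(2) by (intro alt_length[OF assms(1)]) auto
  then show ?thesis
    using alt_add[OF assms(1), of "us @ _"] alt_scale[OF assms(1), of "us @ _"]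
      alt_repeat[OF assms(1), of "us @ _"]
    unfolding alt_forms_iff by simp
qed

text \<open>The degree of the form is irrelevant here: in the wrong degree both sides vanish.\<close>

lemma dec_eval: "\<omega> \<in> alt n \<Longrightarrow> dec vs \<omega> = \<omega> vs"
  using alt_length[of \<omega> n vs] by (cases "length vs = n") (auto simp: decomposable_def)

lemma dec_eval_slice:
  assumes "\<omega> \<in> alt n"
  shows "dec vs (\<lambda>ws. \<omega> (us @ ws)) = \<omega> (us @ vs)"
proof (cases "length (us @ vs) = n")
  case True
  then show ?thesis
    using dec_eval[OF alt_append_left[OF assms]] by simp
next
  case False
  then show ?thesis
    using alt_length[OF assms False] by (simp add: decomposable_def)
qed

text \<open>Multivectors are total functions, so equality must also be checked at functions that are
  not alternating forms, where multivectors are extended by 0.\<close>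

lemma multivector_eqI:
  assumes "\<And>\<omega>. \<omega> \<notin> (\<Union>n. alt n) \<Longrightarrow> \<xi> \<omega> = \<eta> \<omega>" "\<And>n \<omega>. \<omega> \<in> alt n \<Longrightarrow> \<xi> \<omega> = \<eta> \<omega>"
  shows "\<xi> = \<eta>"
  using assms by (auto simp: fun_eq_iff)

lemma dec_outside: "\<omega> \<notin> (\<Union>n. alt n) \<Longrightarrow> dec vs \<omega> = 0"
  by (auto simp: decomposable_def)

lemma dec_add: "dec (as @ (x + y) # bs) = dec (as @ x # bs) + dec (as @ y # bs)"
  by (rule multivector_eqI) (simp_all add: dec_outside dec_eval alt_add fun_simps del: UN_iff)

lemma dec_scale: "dec (as @ s c x # bs) = fscale c (dec (as @ x # bs))"
  by (rule multivector_eqI) (simp_all add: dec_outside dec_eval alt_scale fun_simps del: UN_iff)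

lemma dec_repeat: "\<not> distinct vs \<Longrightarrow> dec vs = 0"
  by (auto simp: decomposable_def alt_forms_def fun_eq_iff fun_simps)

lemma dec_shift: "dec (as @ x # ms @ bs) = fscale ((- 1) ^ length ms) (dec (as @ ms @ x # bs))"
  by (rule multivector_eqI) (simp_all add: dec_outside dec_eval alt_shift[of _ _ as x ms bs] fun_simps del: UN_iff)

text \<open>The head of \<open>vs\<close> is moved to its place in \<open>ws\<close> by
  \<open>dec_shift\<close> and then joins the fixed prefix \<open>us\<close>. Signs are not tracked:
  the applications concern only spans and non-vanishing.\<close>

lemma dec_perm:
  assumes "mset vs = mset ws"
  shows "dec (us @ vs) = dec (us @ ws) \<or> dec (us @ vs) = - dec (us @ ws)"
  using assms
proof (induction vs arbitrary: us ws)
  case (Cons v vs)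
  then obtain as bs where ws: "ws = as @ v # bs"
    by (metis in_set_conv_decomp list.set_intros(1) mset_eq_setD)
  with Cons.prems have "mset vs = mset (as @ bs)"
    by simp
  with Cons.IH[of "as @ bs" "us @ [v]"]
  have "dec (us @ v # vs) = dec (us @ v # as @ bs) \<or> dec (us @ v # vs) = - dec (us @ v # as @ bs)"
    by simp
  moreover have "dec (us @ v # as @ bs) = dec (us @ ws) \<or> dec (us @ v # as @ bs) = - dec (us @ ws)"
    using dec_shift[of us v as bs] ws
    by (cases "even (length as)") (auto simp: fun_eq_iff fun_simps)
  ultimately show ?case
    by auto
qed simp

section \<open>The subspaces \<open>ext p U\<close>\<close>

lemma dec_in_ext: "set vs \<subseteq> U \<Longrightarrow> length vs = p \<Longrightarrow> dec vs \<in> ext p U"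
  unfolding ext_power_def by (rule fs.span_base) auto

lemma subspace_ext: "fs.subspace (ext p U)"
  unfolding ext_power_def by (rule fs.subspace_span)

lemmas ext_closed = fs.subspace_0[OF subspace_ext] fs.subspace_add[OF subspace_ext]
  fs.subspace_diff[OF subspace_ext] fs.subspace_neg[OF subspace_ext] fs.subspace_scale[OF subspace_ext]

lemma ext_induct [consumes 1, case_names zero add scale dec]:
  assumes "\<xi> \<in> ext p U"
    and "P 0" "\<And>\<xi> \<eta>. P \<xi> \<Longrightarrow> P \<eta> \<Longrightarrow> P (\<xi> + \<eta>)" "\<And>c \<xi>. P \<xi> \<Longrightarrow> P (fscale c \<xi>)"
    and "\<And>vs. length vs = p \<Longrightarrow> set vs \<subseteq> U \<Longrightarrow> P (dec vs)"
  shows "P \<xi>"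
proof -
  have "\<xi> \<in> fs.span {dec vs | vs. length vs = p \<and> set vs \<subseteq> U}"
    using assms(1) by (simp add: ext_power_def)
  then show ?thesis
    by (rule fs.span_induct) (use assms in \<open>auto simp: fs.subspace_def\<close>)
qed

lemma ext_mono: "U \<subseteq> U' \<Longrightarrow> ext p U \<subseteq> ext p U'"
  unfolding ext_power_def by (intro fs.span_mono) auto

text \<open>A multivector is just a function of \<open>\<omega>\<close>; elements of
  \<open>ext p U\<close> inherit additivity from the evaluations that span them.\<close>

lemma ext_eval_add:
  assumes "\<xi> \<in> ext p U" "\<omega> \<in> alt n" "\<omega>' \<in> alt n"
  shows "\<xi> (\<omega> + \<omega>') = \<xi> \<omega> + \<xi> \<omega>'"
  using assms(1)
proof (induction rule: ext_induct)
  case (dec vs)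
  show "dec vs (\<omega> + \<omega>') = dec vs \<omega> + dec vs \<omega>'"
    by (simp add: fun_simps dec_eval[OF assms(2)] dec_eval[OF assms(3)]
        dec_eval[OF fs.subspace_add[OF subspace_alt assms(2,3)]])
qed (simp_all add: fun_simps algebra_simps)

lemma ext_eval_scale:
  assumes "\<xi> \<in> ext p U" "\<omega> \<in> alt n"
  shows "\<xi> (fscale c \<omega>) = c * \<xi> \<omega>"
  using assms(1)
proof (induction rule: ext_induct)
  case (dec vs)
  show "dec vs (fscale c \<omega>) = c * dec vs \<omega>"
    by (simp add: fun_simps dec_eval[OF assms(2)] dec_eval[OF fs.subspace_scale[OF subspace_alt assms(2)]])
qed (simp_all add: fun_simps algebra_simps)

text \<open>The inner function in \<open>wedge\<close> is again an alternating form, so linearity of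
  the outer factor can be applied to it.\<close>

lemma ext_slice:
  assumes "\<eta> \<in> ext r U" "\<omega> \<in> alt n"
  shows "(\<lambda>us. \<eta> (\<lambda>vs. \<omega> (us @ vs))) \<in> alt (n - r)"
  using assms(1)
proof (induction rule: ext_induct)
  case zero
  show ?case
    using fs.subspace_0[OF subspace_alt] by (simp add: zero_fun_def)
next
  case (add \<xi> \<eta>)
  then show ?case
    using fs.subspace_add[OF subspace_alt] by (fastforce simp: plus_fun_def)
next
  case (scale c \<xi>)
  then show ?case
    using fs.subspace_scale[OF subspace_alt, of _ _ c] by (fastforce simp: fscale_def)
next
  case (dec vs)
  then show ?case
    using alt_append_right[OF assms(2), of vs] by (simp add: dec_eval_slice[OF assms(2)])
qed

section \<open>The wedge product\<close>

lemma wedge_dec: "wdg (dec us) (dec vs) = dec (us @ vs)"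
proof (rule multivector_eqI)
  fix n \<omega> assume \<omega>: "\<omega> \<in> alt n"
  then have "wdg (dec us) (dec vs) \<omega> = dec us (\<lambda>us. \<omega> (us @ vs))"
    by (auto simp: wedge_def dec_eval_slice)
  also have "\<dots> = dec (us @ vs) \<omega>"
    using \<omega> by (simp add: dec_eval[OF \<omega>] dec_eval[OF alt_append_right[OF \<omega>]])
  finally show "wdg (dec us) (dec vs) \<omega> = dec (us @ vs) \<omega>" .
qed (simp add: wedge_def dec_outside)

lemma wedge_add_left: "wdg (\<xi> + \<xi>') \<eta> = wdg \<xi> \<eta> + wdg \<xi>' \<eta>"
  and wedge_scale_left: "wdg (fscale c \<xi>) \<eta> = fscale c (wdg \<xi> \<eta>)"
  and wedge_zero_left: "wdg 0 \<eta> = 0"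
  by (auto simp: wedge_def fun_eq_iff fun_simps)

text \<open>The second factor sits inside the argument of \<open>\<xi>\<close>, so, unlike on the
  left, linearity of \<open>\<xi>\<close> on forms is required.\<close>

lemma wedge_add_right:
  assumes "\<xi> \<in> ext p U" "\<eta> \<in> ext r U'" "\<eta>' \<in> ext r U'"
  shows "wdg \<xi> (\<eta> + \<eta>') = wdg \<xi> \<eta> + wdg \<xi> \<eta>'"
proof (rule multivector_eqI)
  fix n \<omega> assume \<omega>: "\<omega> \<in> alt n"
  then show "wdg \<xi> (\<eta> + \<eta>') \<omega> = (wdg \<xi> \<eta> + wdg \<xi> \<eta>') \<omega>"
    using ext_eval_add[OF assms(1) ext_slice[OF assms(2) \<omega>] ext_slice[OF assms(3) \<omega>]]
    by (auto simp: wedge_def plus_fun_def)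
qed (simp add: wedge_def fun_simps)

lemma wedge_scale_right:
  assumes "\<xi> \<in> ext p U" "\<eta> \<in> ext r U'"
  shows "wdg \<xi> (fscale c \<eta>) = fscale c (wdg \<xi> \<eta>)"
proof (rule multivector_eqI)
  fix n \<omega> assume \<omega>: "\<omega> \<in> alt n"
  then show "wdg \<xi> (fscale c \<eta>) \<omega> = fscale c (wdg \<xi> \<eta>) \<omega>"
    using ext_eval_scale[OF assms(1) ext_slice[OF assms(2) \<omega>], of c]
    by (auto simp: wedge_def fscale_def)
qed (simp add: wedge_def fun_simps)

lemma wedge_zero_right: "\<xi> \<in> ext p U \<Longrightarrow> wdg \<xi> 0 = 0"
  using wedge_scale_right[of \<xi> p U 0 0 U 0] ext_closed(1) by simp

lemma wedge_in_ext:
  assumes "\<xi> \<in> ext p U" "\<eta> \<in> ext r U"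
  shows "wdg \<xi> \<eta> \<in> ext (p + r) U"
  using assms(1)
proof (induction rule: ext_induct)
  case (dec us)
  note us = dec_in_ext[OF dec(2,1)]
  \<comment> \<open>Membership of \<open>\<eta>\<close> is carried through the induction because
    right linearity of the wedge asks for it; later inductions repeat this device.\<close>
  have "wdg (dec us) \<eta> \<in> ext (p + r) U \<and> \<eta> \<in> ext r U"
    using assms(2)
  proof (induction rule: ext_induct)
    case (dec vs)
    then show ?case
      using \<open>set us \<subseteq> U\<close> \<open>length us = p\<close> by (simp add: wedge_dec dec_in_ext)
  qed (auto simp: wedge_zero_right[OF us] wedge_add_right[OF us] wedge_scale_right[OF us] ext_closed)
  then show ?case ..
qed (auto simp: wedge_add_left wedge_scale_left wedge_zero_left ext_closed)

text \<open>The value of \<open>l \<and> \<omega>\<close>, in a recursive form that makes its alternation provable by splitting lists.\<close>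

fun skew_sum :: "('v \<Rightarrow> 'k) \<Rightarrow> ('v list \<Rightarrow> 'k) \<Rightarrow> 'v list \<Rightarrow> 'k" where
  "skew_sum l \<omega> [] = 0"
| "skew_sum l \<omega> (v # vs) = l v * \<omega> vs - skew_sum l (\<lambda>us. \<omega> (v # us)) vs"

section \<open>Contraction with a linear form\<close>

lemma skew_sum_eq:
  "(\<Sum>i<length vs. (-1) ^ i * l (vs ! i) * \<omega> (take i vs @ drop (Suc i) vs)) = skew_sum l \<omega> vs"
proof (induction vs arbitrary: \<omega>)
  case (Cons v vs)
  show ?case
    unfolding skew_sum.simps Cons[symmetric]
    by (simp add: sum.lessThan_Suc_shift sum_negf mult.assoc del: sum.lessThan_Suc)
qed simp

text \<open>The deleted entry lies in \<open>as\<close> or in \<open>bs\<close>; in the latter case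
  its position is shifted by the length of \<open>as\<close>, whence the sign.\<close>

lemma skew_sum_append:
  "skew_sum l \<omega> (as @ bs) =
     skew_sum l (\<lambda>us. \<omega> (us @ bs)) as + (-1) ^ length as * skew_sum l (\<lambda>us. \<omega> (as @ us)) bs"
  by (induction as arbitrary: \<omega>) (simp_all add: algebra_simps)

lemma skew_sum_zero [simp]: "skew_sum l (\<lambda>us. 0) vs = 0"
  by (induction vs) auto

lemma skew_sum_plus: "skew_sum l (\<lambda>us. f us + g us) vs = skew_sum l f vs + skew_sum l g vs"
  by (induction vs arbitrary: f g) (auto simp: algebra_simps)

lemma skew_sum_times: "skew_sum l (\<lambda>us. c * f us) vs = c * skew_sum l f vs"
  by (induction vs arbitrary: f) (auto simp: algebra_simps)

lemma skew_sum_length: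
  assumes "\<And>us. Suc (length us) = length vs \<Longrightarrow> \<omega> us = 0"
  shows "skew_sum l \<omega> vs = 0"
  using assms by (induction vs arbitrary: \<omega>) auto

lemma skew_sum_alt:
  assumes l: "Vector_Spaces.linear s (*) l" and \<omega>: "\<omega> \<in> alt n"
  shows "skew_sum l \<omega> \<in> alt (Suc n)"
proof -
  note lin = l[unfolded linear_functional_iff]
  have "skew_sum l \<omega> vs = 0" if "length vs \<noteq> Suc n" for vs
    using that by (intro skew_sum_length alt_length[OF \<omega>]) auto
  moreover have "skew_sum l \<omega> (as @ (x + y) # bs) = skew_sum l \<omega> (as @ x # bs) + skew_sum l \<omega> (as @ y # bs)"
    for as x y bs
    using lin by (simp add: skew_sum_append alt_add[OF \<omega>] skew_sum_plus algebra_simps)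
  moreover have "skew_sum l \<omega> (as @ s c x # bs) = c * skew_sum l \<omega> (as @ x # bs)" for as c x bs
    using lin by (simp add: skew_sum_append alt_scale[OF \<omega>] skew_sum_times algebra_simps)
  moreover have "skew_sum l \<omega> (as @ x # ms @ x # bs) = 0" for as x ms bs
  proof -
    \<comment> \<open>Only the deletions of one of the two copies of \<open>x\<close> survive; by
      \<open>alt_shift\<close> these two terms cancel.\<close>
    have "\<omega> (as @ x # us @ x # bs) = 0" "\<omega> (as @ x # ms @ x # us) = 0" "\<omega> (us @ x # ms @ x # bs) = 0" for us
      using alt_repeat[OF \<omega>] by auto
    then show ?thesis
      using alt_shift[OF \<omega>, of as x ms bs]
      by (simp add: skew_sum_append algebra_simps flip: power_add)
  qed
  ultimately show ?thesis
    unfolding alt_forms_iff by blast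
qed

lemma contract_dec:
  assumes "Vector_Spaces.linear s (*) l" "\<omega> \<in> alt n"
  shows "contract s l (dec vs) \<omega> = skew_sum l \<omega> vs"
  using assms by (auto simp: contract_def skew_sum_eq dec_eval[OF skew_sum_alt])

lemma contract_add: "contract s l (\<xi> + \<xi>') = contract s l \<xi> + contract s l \<xi>'"
  and contract_scale: "contract s l (fscale c \<xi>) = fscale c (contract s l \<xi>)"
  and contract_zero: "contract s l 0 = 0"
  by (auto simp: contract_def fun_eq_iff fun_simps)

text \<open>Every term other than the first has a factor \<open>l u\<close> with \<open>u\<close> in
  \<open>us\<close>.\<close>

lemma contract_dec_Cons:
  assumes "Vector_Spaces.linear s (*) l" "\<And>u. u \<in> set us \<Longrightarrow> l u = 0"
  shows "contract s l (dec (v # us)) = fscale (l v) (dec us)"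
proof (rule multivector_eqI)
  have *: "skew_sum l \<omega> us = 0" for \<omega>
    using assms(2) by (induction us arbitrary: \<omega>) auto
  fix n \<omega> assume "\<omega> \<in> alt n"
  then show "contract s l (dec (v # us)) \<omega> = fscale (l v) (dec us) \<omega>"
    by (simp add: contract_dec[OF assms(1)] dec_eval fun_simps *)
qed (simp add: contract_def dec_outside fun_simps)

lemma contract_ext_eq_0:
  assumes "Vector_Spaces.linear s (*) l" "\<And>u. u \<in> U \<Longrightarrow> l u = 0" "\<xi> \<in> ext p U"
  shows "contract s l \<xi> = 0"
  using assms(3)
proof (induction rule: ext_induct)
  case (dec vs)
  have *: "skew_sum l \<omega> vs = 0" for \<omega>
    using dec(2) by (induction vs arbitrary: \<omega>) (use assms(2) in auto)
  show ?case
  proof (rule multivector_eqI)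
    fix n \<omega> assume "\<omega> \<in> alt n"
    then show "contract s l (dec vs) \<omega> = 0 \<omega>"
      by (simp add: contract_dec[OF assms(1)] fun_simps *)
  qed (simp add: contract_def fun_simps)
qed (auto simp: contract_add contract_scale contract_zero)

text \<open>Multilinearity allows the entries to be replaced by elements of \<open>B\<close> one at
  a time; \<open>as\<close> is the part already replaced.\<close>

lemma ext_subset_span:
  assumes "U \<subseteq> span B"
  shows "ext p U \<subseteq> fs.span {dec vs | vs. length vs = p \<and> set vs \<subseteq> B}"
proof -
  let ?S = "fs.span {dec vs | vs. length vs = p \<and> set vs \<subseteq> B}"
  have "dec (as @ bs) \<in> ?S"
    if "set as \<subseteq> B" "set bs \<subseteq> U" "length as + length bs = p" for as bs
    using that
  proof (induction bs arbitrary: as)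
    case Nil
    then show ?case
      by (intro fs.span_base) auto
  next
    case (Cons u bs)
    have "subspace {x. dec (as @ x # bs) \<in> ?S}"
      using dec_scale[of as 0 0 bs]
      by (auto simp: subspace_def dec_add dec_scale fs.span_add fs.span_scale fs.span_zero)
    moreover have "dec (as @ x # bs) \<in> ?S" if "x \<in> B" for x
      using Cons.IH[of "as @ [x]"] Cons.prems that by simp
    moreover have "u \<in> span B"
      using Cons.prems assms by auto
    ultimately show ?case
      by (metis (mono_tags, lifting) mem_Collect_eq span_induct)
  qed
  from this[of "[]"] show ?thesis
    unfolding ext_power_def by (intro fs.span_minimal) auto
qed

text \<open>Lists with a repetition give 0; the others agree up to sign with the chosen listing of
  their set of entries.\<close>

lemma ext_eq_span_subsets:
  assumes "finite B" "\<And>S. S \<subseteq> B \<Longrightarrow> distinct (ls S) \<and> set (ls S) = S"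
  shows "ext p (span B) = fs.span ((\<lambda>S. dec (ls S)) ` {S. S \<subseteq> B \<and> card S = p})" (is "_ = ?S")
proof
  have "dec vs \<in> ?S" if "length vs = p" "set vs \<subseteq> B" for vs
  proof (cases "distinct vs")
    case True
    with that have "card (set vs) = p"
      by (simp add: distinct_card)
    then have "dec (ls (set vs)) \<in> ?S"
      using that by (intro fs.span_base) auto
    moreover have "mset vs = mset (ls (set vs))"
      using assms(2)[OF that(2)] True by (metis set_eq_iff_mset_eq_distinct)
    ultimately show ?thesis
      using dec_perm[of vs "ls (set vs)" "[]"] by (auto intro: fs.span_neg)
  qed (simp add: dec_repeat fs.span_zero)
  then have "fs.span {dec vs | vs. length vs = p \<and> set vs \<subseteq> B} \<subseteq> ?S"
    by (intro fs.span_minimal) auto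
  with ext_subset_span[of "span B" B p] show "ext p (span B) \<subseteq> ?S"
    by auto
next
  have "dec (ls S) \<in> ext p (span B)" if "S \<subseteq> B" "card S = p" for S
    using assms(2)[OF that(1)] that span_superset[of B]
    by (intro dec_in_ext) (auto simp flip: distinct_card)
  then show "?S \<subseteq> ext p (span B)"
    by (intro fs.span_minimal subspace_ext) auto
qed

text \<open>\<open>v\<close> passes \<open>p\<close> vectors, one sign each. Decomposable
  \<open>\<eta>\<close> comes first, by induction on \<open>\<beta>\<close>; the result is then
  extended linearly in \<open>\<eta>\<close>.\<close>

lemma wedge_vector_commute:
  assumes "\<eta> \<in> ext p U" "\<beta> \<in> ext r U'"
  shows "wdg \<eta> (wdg (dec [v]) \<beta>) = fscale ((-1) ^ p) (wdg (dec [v]) (wdg \<eta> \<beta>))"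
proof -
  have v: "dec [v] \<in> ext 1 UNIV"
    by (rule dec_in_ext) auto
  have \<beta>: "\<beta> \<in> ext r UNIV" and \<eta>: "\<eta> \<in> ext p UNIV"
    using assms ext_mono by blast+
  have dec: "wdg (dec us) (wdg (dec [v]) \<beta>) = fscale ((-1) ^ p) (wdg (dec [v]) (wdg (dec us) \<beta>))"
    if us: "length us = p" for us
  proof -
    have u: "dec us \<in> ext p UNIV"
      using us by (intro dec_in_ext) auto
    have "\<beta> \<in> ext r UNIV \<and> ?thesis"
      using \<beta>
    proof (induction rule: ext_induct)
      case zero
      show ?case
        by (simp add: wedge_zero_right[OF u] wedge_zero_right[OF v] ext_closed)
    next
      case (add \<xi> \<eta>)
      then show ?case
        by (simp add: ext_closed wedge_add_right[OF u, of _ r UNIV] wedge_add_right[OF v, of _ r UNIV]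
            wedge_add_right[OF u wedge_in_ext[OF v] wedge_in_ext[OF v], of _ r]
            wedge_add_right[OF v wedge_in_ext[OF u] wedge_in_ext[OF u], of _ r]
            fs.scale_right_distrib)
    next
      case (scale c \<xi>)
      then show ?case
        by (simp add: ext_closed wedge_scale_right[OF u, of _ r UNIV] wedge_scale_right[OF v, of _ r UNIV]
            wedge_scale_right[OF u wedge_in_ext[OF v], of _ r]
            wedge_scale_right[OF v wedge_in_ext[OF u], of _ r] mult.commute)
    next
      case (dec ws)
      have "dec (us @ v # ws) = fscale ((-1) ^ p) (dec (v # us @ ws))"
        using dec_shift[of "[]" v us ws] us by (simp flip: power_add)
      then show ?case
        using dec by (simp add: wedge_dec dec_in_ext)
    qed
    then show ?thesis ..
  qed
  have "\<eta> \<in> ext p UNIV \<and> ?thesis"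
    using \<eta>
  proof (induction rule: ext_induct)
    case (add \<xi> \<eta>)
    then show ?case
      using wedge_in_ext[OF _ \<beta>]
      by (simp add: ext_closed wedge_add_left wedge_add_right[OF v, of _ "p + r" UNIV] fs.scale_right_distrib)
  next
    case (scale c \<xi>)
    then show ?case
      using wedge_in_ext[OF _ \<beta>]
      by (simp add: ext_closed wedge_scale_left wedge_scale_right[OF v, of _ "p + r" UNIV] mult.commute)
  qed (simp_all add: dec dec_in_ext ext_closed wedge_zero_left wedge_zero_right[OF v])
  then show ?thesis ..
qed

lemma contract_vector_wedge:
  assumes l: "Vector_Spaces.linear s (*) l" "\<And>u. u \<in> U \<Longrightarrow> l u = 0" and \<beta>: "\<beta> \<in> ext p U"
  shows "contract s l (wdg (dec [v]) \<beta>) = fscale (l v) \<beta>"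
proof -
  have v: "dec [v] \<in> ext 1 UNIV"
    by (rule dec_in_ext) auto
  have "\<beta> \<in> ext p U \<and> ?thesis"
    using \<beta>
  proof (induction rule: ext_induct)
    case (dec us)
    then show ?case
      using l(2) by (simp add: wedge_dec dec_in_ext contract_dec_Cons[OF l(1)] subset_iff)
  qed (simp_all add: ext_closed wedge_zero_right[OF v] wedge_add_right[OF v, of _ p U]
      wedge_scale_right[OF v, of _ p U] contract_add contract_scale contract_zero fs.scale_right_distrib
      mult.commute)
  then show ?thesis ..
qed

end

section \<open>Splitting off a vector outside the hyperplane\<close>

locale hyperplane = exterior s for s :: "'k::field \<Rightarrow> 'v::ab_group_add \<Rightarrow> 'v" +
  fixes V5 :: "'v set"
  assumes subspace_V5: "subspace V5"
    and dim_V6: "dim UNIV = 6" and dim_V5: "dim V5 = 5"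
begin

section \<open>The line \<open>L\<close> and complements of \<open>V5\<close>\<close>

abbreviation "LL \<equiv> L_space s V5"

lemma L_linear: "l \<in> LL \<Longrightarrow> Vector_Spaces.linear s (*) l"
  and L_vanish: "l \<in> LL \<Longrightarrow> u \<in> V5 \<Longrightarrow> l u = 0"
  by (auto simp: L_space_def)

lemma subspace_L: "fs.subspace LL"
  by (auto simp: fs.subspace_def L_space_def linear_functional_iff fun_simps algebra_simps)

lemma V5_basis:
  obtains B where "finite B" "card B = 5" "independent B" "span B = V5"
proof -
  obtain B where B: "B \<subseteq> V5" "independent B" "V5 \<subseteq> span B" "card B = dim V5"
    by (rule basis_exists)
  then have "finite B" "card B = 5"
    using dim_V5 by (auto intro: card_ge_0_finite)
  moreover have "span B = V5"
    using B subspace_V5 span_minimal by blast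
  ultimately show ?thesis
    using that B(2) by blast
qed

text \<open>Otherwise \<open>v\<close>, a basis of \<open>V5\<close> and one further vector would be
  seven independent vectors in dimension 6.\<close>

lemma span_insert_V5:
  assumes "v \<notin> V5"
  shows "span (insert v V5) = UNIV"
proof -
  obtain B where B: "finite B" "card B = 5" "independent B" "span B = V5"
    by (rule V5_basis)
  obtain C where C: "independent C" "UNIV \<subseteq> span C" "card C = dim UNIV"
    by (rule basis_exists)
  have finC: "finite C"
    using C(3) dim_V6 by (auto intro: card_ge_0_finite)
  have "v \<notin> span B"
    using B assms by simp
  then have vB: "independent (insert v B)" "card (insert v B) = 6"
    using B span_base[of v B] by (auto simp: independent_insert card_insert_if)
  have "x \<in> span (insert v B)" for x
  proof (rule ccontr)
    assume x: "x \<notin> span (insert v B)"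
    then have "independent (insert x (insert v B))"
      using vB(1) by (auto simp: independent_insert span_base)
    moreover have "x \<notin> insert v B"
      using x span_base by blast
    then have "card (insert x (insert v B)) = 7"
      using vB(2) B(1) by simp
    ultimately show False
      using independent_span_bound[OF finC, of "insert x (insert v B)"] C dim_V6 by auto
  qed
  moreover have "span (insert v B) \<subseteq> span (insert v V5)"
    using B(4) span_superset[of B] by (intro span_mono) auto
  ultimately show ?thesis
    by blast
qed

lemma exists_functional:
  assumes "v \<notin> V5"
  obtains l where "l \<in> LL" "l v = 1"
proof -
  obtain B where B: "finite B" "card B = 5" "independent B" "span B = V5"
    by (rule V5_basis)
  interpret vector_space_pair s "(*) :: 'k \<Rightarrow> 'k \<Rightarrow> 'k"
    by (intro vector_space_pair.intro vector_space_axioms vector_space_field)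
  have "v \<notin> span B"
    using B assms by simp
  then have "independent (insert v B)"
    using B by (auto simp: independent_insert)
  then obtain l where l: "Vector_Spaces.linear s (*) l" "\<forall>x\<in>insert v B. l x = (if x = v then 1 else 0)"
    using linear_independent_extend[of "insert v B" "\<lambda>x. if x = v then 1 else 0"] by blast
  have "\<forall>x\<in>B. l x = 0"
    using l(2) \<open>v \<notin> span B\<close> span_base by fastforce
  then have "\<forall>x\<in>V5. l x = 0"
    using linear_eq_0_on_span[OF l(1), of B] B(4) by blast
  then show ?thesis
    using that[of l] l by (auto simp: L_space_def)
qed

lemma V5_proper: obtains v where "v \<notin> V5"
proof -
  have "V5 \<noteq> UNIV"
    using dim_V5 dim_V6 by auto
  then show ?thesis
    using that by blast
qed

text \<open>By \<open>span_insert_V5\<close>, a form vanishing on \<open>V5\<close> is determined by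
  its value at \<open>v\<close>; so \<open>L\<close> is a line.\<close>

lemma L_eq:
  assumes "v \<notin> V5" "l \<in> LL" "l' \<in> LL" "l' v = 1"
  shows "l = fscale (l v) l'"
proof
  fix x
  have "x \<in> span (insert v V5)"
    using span_insert_V5[OF assms(1)] by simp
  then obtain k where "x - s k v \<in> span V5"
    by (auto simp: span_insert)
  then have "x - s k v \<in> V5"
    using subspace_V5 by (metis span_eq_iff)
  then obtain u where u: "u \<in> V5" "x = s k v + u"
    by (metis add.commute diff_add_cancel)
  have "l x = k * l v" "l' x = k"
    using u assms L_linear[OF assms(2)] L_linear[OF assms(3)] L_vanish[OF assms(2) u(1)]
      L_vanish[OF assms(3) u(1)] by (simp_all add: linear_functional_iff)
  then show "l x = fscale (l v) l' x"
    by (simp add: fscale_apply)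
qed

lemma ext_6_V5: "ext 6 V5 = {0}"
proof -
  obtain B where B: "finite B" "card B = 5" "independent B" "span B = V5"
    by (rule V5_basis)
  from enumerate_subsets[OF B(1)]
  obtain ls where ls: "\<forall>S. S \<subseteq> B \<longrightarrow> distinct (ls S) \<and> set (ls S) = S" ..
  have "card S \<noteq> 6" if "S \<subseteq> B" for S
    using card_mono[OF B(1) that] B(2) by simp
  then have none: "{S. S \<subseteq> B \<and> card S = 6} = {}"
    by auto
  have "ext 6 (span B) = fs.span ((\<lambda>S. dec (ls S)) ` {S. S \<subseteq> B \<and> card S = 6})"
    using B(1) ls by (intro ext_eq_span_subsets) auto
  then show ?thesis
    by (simp only: none B(4) image_empty fs.span_empty)
qed

end

text \<open>Fixing \<open>v\<close> splits off a line complementary to \<open>V5\<close>, and the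
  normalised \<open>l\<close> trivialises \<open>L\<close>, so twisted multivectors can be read off
  at \<open>l\<close>.\<close>

locale split_hyperplane = hyperplane +
  fixes v l
  assumes v: "v \<notin> V5" and l: "l \<in> LL" and lv: "l v = 1"
begin

abbreviation "vw \<equiv> wdg (dec [v])"
abbreviation "con \<equiv> contract s l"

lemma v_in_ext: "dec [v] \<in> ext 1 UNIV"
  by (rule dec_in_ext) auto

lemma vw_in_ext: "\<beta> \<in> ext p U \<Longrightarrow> vw \<beta> \<in> ext (Suc p) UNIV"
  using wedge_in_ext[OF v_in_ext, of \<beta> p] ext_mono[OF subset_UNIV, of p U] by auto

text \<open>Generators over \<open>insert v V5\<close> suffice: \<open>v\<close> is absent, occurs
  once and can be moved to the front, or is repeated and gives 0.\<close>

lemma decompose: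
  assumes "\<xi> \<in> ext (Suc p) UNIV"
  obtains \<alpha> \<beta> where "\<alpha> \<in> ext (Suc p) V5" "\<beta> \<in> ext p V5" "\<xi> = \<alpha> + vw \<beta>"
proof -
  let ?D = "{\<alpha> + vw \<beta> | \<alpha> \<beta>. \<alpha> \<in> ext (Suc p) V5 \<and> \<beta> \<in> ext p V5}"
  have D: "fs.subspace ?D"
    unfolding fs.subspace_def
  proof (intro conjI ballI allI)
    have "0 = 0 + vw 0"
      using wedge_zero_right[OF v_in_ext] by simp
    with ext_closed(1) show "0 \<in> ?D"
      by blast
  next
    fix x y assume "x \<in> ?D" "y \<in> ?D"
    then obtain \<alpha> \<beta> \<alpha>' \<beta>' where
      *: "\<alpha> \<in> ext (Suc p) V5" "\<beta> \<in> ext p V5" "\<alpha>' \<in> ext (Suc p) V5" "\<beta>' \<in> ext p V5"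
        "x = \<alpha> + vw \<beta>" "y = \<alpha>' + vw \<beta>'"
      by auto
    have "x + y = (\<alpha> + \<alpha>') + vw (\<beta> + \<beta>')"
      using * by (simp add: wedge_add_right[OF v_in_ext, of _ p V5])
    with * ext_closed(2) show "x + y \<in> ?D"
      by blast
  next
    fix c x assume "x \<in> ?D"
    then obtain \<alpha> \<beta> where *: "\<alpha> \<in> ext (Suc p) V5" "\<beta> \<in> ext p V5" "x = \<alpha> + vw \<beta>"
      by auto
    have "fscale c x = fscale c \<alpha> + vw (fscale c \<beta>)"
      using * by (simp add: wedge_scale_right[OF v_in_ext, of _ p V5] fs.scale_right_distrib)
    with * ext_closed(5) show "fscale c x \<in> ?D"
      by blast
  qed
  have "dec vs \<in> ?D" if vs: "length vs = Suc p" "set vs \<subseteq> insert v V5" for vs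
  proof (cases "v \<in> set vs")
    case False
    then have "dec vs \<in> ext (Suc p) V5"
      using vs by (intro dec_in_ext) auto
    moreover have "dec vs = dec vs + vw 0"
      using wedge_zero_right[OF v_in_ext] by simp
    ultimately show ?thesis
      using ext_closed(1) by blast
  next
    case True
    then obtain as bs where ab: "vs = as @ v # bs"
      by (metis in_set_conv_decomp)
    have shift: "dec vs = fscale ((-1) ^ length as) (dec (v # as @ bs))"
      using dec_shift[of "[]" v as bs] ab by (simp flip: power_add)
    show ?thesis
    proof (cases "v \<in> set as \<union> set bs")
      case True
      then have "dec vs = 0"
        using ab by (intro dec_repeat) auto
      then show ?thesis
        using fs.subspace_0[OF D] by simp
    next
      case False
      then have "dec (as @ bs) \<in> ext p V5"
        using vs ab by (intro dec_in_ext) auto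
      moreover have "dec (v # as @ bs) = 0 + vw (dec (as @ bs))"
        by (simp add: wedge_dec)
      ultimately have "dec (v # as @ bs) \<in> ?D"
        using ext_closed(1) by blast
      then show ?thesis
        unfolding shift by (rule fs.subspace_scale[OF D])
    qed
  qed
  then have "fs.span {dec vs |vs. length vs = Suc p \<and> set vs \<subseteq> insert v V5} \<subseteq> ?D"
    by (intro fs.span_minimal D) blast
  moreover have "\<xi> \<in> fs.span {dec vs |vs. length vs = Suc p \<and> set vs \<subseteq> insert v V5}"
    using ext_subset_span[of UNIV "insert v V5" "Suc p"] span_insert_V5[OF v] assms by blast
  ultimately have "\<xi> \<in> ?D" ..
  then show ?thesis
    using that by blast
qed

lemma contract_V5: "m \<in> LL \<Longrightarrow> \<alpha> \<in> ext p V5 \<Longrightarrow> contract s m \<alpha> = 0"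
  by (rule contract_ext_eq_0[OF L_linear L_vanish])

lemma contract_vw: "m \<in> LL \<Longrightarrow> \<beta> \<in> ext p V5 \<Longrightarrow> contract s m (vw \<beta>) = fscale (m v) \<beta>"
  by (rule contract_vector_wedge[OF L_linear L_vanish])

lemma con_split: "\<alpha> \<in> ext p V5 \<Longrightarrow> \<beta> \<in> ext r V5 \<Longrightarrow> con (\<alpha> + vw \<beta>) = \<beta>"
  by (simp add: contract_add contract_V5[OF l] contract_vw[OF l] lv)

lemma con_in_ext: "\<xi> \<in> ext (Suc p) UNIV \<Longrightarrow> con \<xi> \<in> ext p V5"
  by (erule decompose) (simp add: con_split)

text \<open>In \<open>\<alpha> + vw \<beta>\<close> the contraction sees only
  \<open>\<beta>\<close>, with factor \<open>m v\<close>. So \<open>lam\<close> is determined by its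
  value at \<open>l\<close>.\<close>

lemma contract_eq:
  assumes "m \<in> LL" "\<xi> \<in> ext (Suc p) UNIV"
  shows "contract s m \<xi> = fscale (m v) (con \<xi>)"
proof -
  obtain \<alpha> \<beta> where "\<alpha> \<in> ext (Suc p) V5" "\<beta> \<in> ext p V5" "\<xi> = \<alpha> + vw \<beta>"
    using decompose[OF assms(2)] .
  then show ?thesis
    using con_split by (simp add: contract_add[of m] contract_V5[OF assms(1)] contract_vw[OF assms(1)])
qed

lemma con_eq_0_iff:
  assumes "\<xi> \<in> ext (Suc p) UNIV"
  shows "con \<xi> = 0 \<longleftrightarrow> \<xi> \<in> ext (Suc p) V5"
proof -
  obtain \<alpha> \<beta> where "\<alpha> \<in> ext (Suc p) V5" "\<beta> \<in> ext p V5" "\<xi> = \<alpha> + vw \<beta>"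
    using decompose[OF assms] .
  then show ?thesis
    using con_split[of \<alpha> "Suc p" \<beta> p] wedge_zero_right[OF v_in_ext] contract_V5[OF l, of \<xi> "Suc p"]
    by auto
qed

text \<open>The part \<open>wdg \<eta> \<alpha>\<close> lives over \<open>V5\<close> and is killed;
  in the other part \<open>v\<close> has to pass the \<open>p\<close> factors of
  \<open>\<eta>\<close>.\<close>

lemma con_wedge:
  assumes \<eta>: "\<eta> \<in> ext p V5" and \<xi>: "\<xi> \<in> ext (Suc r) UNIV"
  shows "con (wdg \<eta> \<xi>) = fscale ((-1) ^ p) (wdg \<eta> (con \<xi>))"
proof -
  obtain \<alpha> \<beta> where *: "\<alpha> \<in> ext (Suc r) V5" "\<beta> \<in> ext r V5" "\<xi> = \<alpha> + vw \<beta>"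
    using decompose[OF \<xi>] .
  have "wdg \<eta> \<xi> = wdg \<eta> \<alpha> + fscale ((-1) ^ p) (vw (wdg \<eta> \<beta>))"
    using * wedge_vector_commute[OF \<eta> *(2)] ext_mono[of V5 UNIV]
      wedge_add_right[OF \<eta>, of \<alpha> "Suc r" UNIV "vw \<beta>"] vw_in_ext by auto
  then show ?thesis
    using wedge_in_ext[OF \<eta> *(1)] wedge_in_ext[OF \<eta> *(2)] *
    by (simp add: contract_add contract_scale contract_V5[OF l] contract_vw[OF l] con_split lv)
qed

text \<open>In degree 6 the contraction is injective because \<open>ext 6 V5\<close> is zero. This
  turns orthogonality over the whole space into a pairing over \<open>V5\<close>.\<close>

lemma wedge_eq_0_iff:
  assumes \<eta>: "\<eta> \<in> ext 3 V5" and \<xi>: "\<xi> \<in> ext 3 UNIV"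
  shows "wdg \<eta> \<xi> = 0 \<longleftrightarrow> wdg \<eta> (con \<xi>) = 0"
proof -
  have "wdg \<eta> \<xi> \<in> ext 6 UNIV"
    using wedge_in_ext[of \<eta> 3 UNIV \<xi> 3] \<eta> \<xi> ext_mono[of V5 UNIV] by auto
  then have "wdg \<eta> \<xi> = 0 \<longleftrightarrow> con (wdg \<eta> \<xi>) = 0"
    using con_eq_0_iff[of "wdg \<eta> \<xi>" 5] ext_6_V5 by (auto simp: contract_zero)
  moreover have "con (wdg \<eta> \<xi>) = 0 \<longleftrightarrow> wdg \<eta> (con \<xi>) = 0"
    using con_wedge[OF \<eta>, of \<xi> 2] \<xi> by (simp add: fs.scale_eq_0_iff)
  ultimately show ?thesis
    by blast
qed

end

section \<open>Perfect pairing of 2-vectors and 3-vectors of \<open>V5\<close>\<close>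

context hyperplane
begin

lemma ext_V5_finite: "\<exists>S. finite S \<and> ext p V5 = fs.span S"
proof -
  obtain B where B: "finite B" "card B = 5" "independent B" "span B = V5"
    by (rule V5_basis)
  from enumerate_subsets[OF B(1)]
  obtain ls where ls: "\<forall>S. S \<subseteq> B \<longrightarrow> distinct (ls S) \<and> set (ls S) = S" ..
  have "ext p (span B) = fs.span ((\<lambda>S. dec (ls S)) ` {S. S \<subseteq> B \<and> card S = p})"
    using B(1) ls by (intro ext_eq_span_subsets) auto
  then show ?thesis
    using B by (intro exI[of _ "(\<lambda>S. dec (ls S)) ` {S. S \<subseteq> B \<and> card S = p}"]) simp
qed

text \<open>A 2-subset \<open>S\<close> of a basis is paired with the complementary 3-subset, which
  gives dual bases once \<open>ext 5 V5\<close> is known to be nonzero; there are 10 such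
  \<open>S\<close>.\<close>

lemma dim_wedge_annihilator:
  assumes nz: "ext 5 V5 \<noteq> {0}" and U: "fs.subspace U" "U \<subseteq> ext 2 V5"
  shows "fs.dim U + fs.dim {\<eta> \<in> ext 3 V5. \<forall>\<beta>\<in>U. wdg \<eta> \<beta> = 0} = 10"
proof -
  obtain B where B: "finite B" "card B = 5" "independent B" "span B = V5"
    by (rule V5_basis)
  from enumerate_subsets[OF B(1)]
  obtain ls where ls: "\<forall>S. S \<subseteq> B \<longrightarrow> distinct (ls S) \<and> set (ls S) = S" ..
  have span: "ext p V5 = fs.span ((\<lambda>S. dec (ls S)) ` {S. S \<subseteq> B \<and> card S = p})" for p
    using ext_eq_span_subsets[OF B(1), of ls p] ls B(4) by blast
  have "S = B" if "S \<subseteq> B" "card S = 5" for S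
    using card_subset_eq[OF B(1) that(1)] that(2) B(2) by simp
  then have "{S. S \<subseteq> B \<and> card S = 5} = {B}"
    using B(2) by auto
  then have ext5: "ext 5 V5 = fs.span {dec (ls B)}"
    by (simp add: span)
  have "dec (ls B) \<noteq> 0"
  proof
    assume "dec (ls B) = 0"
    then have "ext 5 V5 = {0}"
      by (simp only: ext5 fs.span_insert_0 fs.span_empty)
    with nz show False ..
  qed
  \<comment> \<open>A form \<open>\<omega>\<close> detecting the top vector turns the wedge into a
    scalar pairing, without loss because \<open>ext 5 V5\<close> is spanned by that vector.\<close>
  then have "\<exists>n \<omega>. \<omega> \<in> alt n \<and> dec (ls B) \<omega> \<noteq> 0"
    using multivector_eqI[of "dec (ls B)" 0] dec_outside[of _ "ls B"] by (metis zero_fun_apply)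
  then obtain n \<omega> where \<omega>: "\<omega> \<in> alt n" "dec (ls B) \<omega> \<noteq> 0"
    by blast
  define p where "p \<eta> \<beta> = wdg \<eta> \<beta> \<omega>" for \<eta> \<beta>
  have p_eq_0: "p \<eta> \<beta> = 0 \<longleftrightarrow> wdg \<eta> \<beta> = 0" if "\<eta> \<in> ext 3 V5" "\<beta> \<in> ext 2 V5" for \<eta> \<beta>
  proof -
    have "wdg \<eta> \<beta> \<in> fs.span {dec (ls B)}"
      using wedge_in_ext[OF that] ext5 by simp
    then obtain c where "wdg \<eta> \<beta> = fscale c (dec (ls B))"
      by (auto simp: fs.span_singleton)
    then show ?thesis
      using \<omega>(2) by (auto simp: p_def fun_simps)
  qed
  let ?I = "{S. S \<subseteq> B \<and> card S = 2}"
  \<comment> \<open>The order of \<open>ls (B - S) @ ls S\<close> is arbitrary, so its sign is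
    unknown; \<open>d\<close> divides by \<open>c S\<close> to make the pairing 1.\<close>
  define c where "c S = dec (ls (B - S) @ ls S) \<omega>" for S
  have c: "c S \<noteq> 0" if "S \<in> ?I" for S
  proof -
    have "distinct (ls (B - S) @ ls S)" "set (ls (B - S) @ ls S) = B"
      using ls that Diff_subset[of B S] by auto
    then have "mset (ls (B - S) @ ls S) = mset (ls B)"
      using ls set_eq_iff_mset_eq_distinct[of "ls (B - S) @ ls S" "ls B"] by auto
    then show ?thesis
      using dec_perm[of _ _ "[]"] \<omega>(2) unfolding c_def by (fastforce simp: fun_simps)
  qed
  define d where "d S = fscale (1 / c S) (dec (ls (B - S)))" for S
  have card_diff: "card (B - S) = 3" if "S \<in> ?I" for S
    using that B(2) card_Diff_subset[OF finite_subset[OF _ B(1)], of S B] by simp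
  have F: "ext 3 V5 = fs.span (d ` ?I)"
  proof
    have "dec (ls T) \<in> fs.span (d ` ?I)" if T: "T \<subseteq> B" "card T = 3" for T
    proof -
      have S: "B - T \<in> ?I" "B - (B - T) = T"
        using T B(2) card_Diff_subset[OF finite_subset[OF T(1) B(1)] T(1)] by auto
      then have "dec (ls T) = fscale (c (B - T)) (d (B - T))"
        using c[OF S(1)] by (simp add: d_def)
      moreover have "fscale (c (B - T)) (d (B - T)) \<in> fs.span (d ` ?I)"
        using S(1) by (intro fs.span_scale fs.span_base imageI)
      ultimately show ?thesis
        by simp
    qed
    then show "ext 3 V5 \<subseteq> fs.span (d ` ?I)"
      unfolding span by (intro fs.span_minimal) auto
    have "d S \<in> ext 3 V5" if "S \<in> ?I" for S
      unfolding span d_def using card_diff[OF that]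
      by (intro fs.span_scale fs.span_base imageI) auto
    then show "fs.span (d ` ?I) \<subseteq> ext 3 V5"
      by (intro fs.span_minimal subspace_ext) auto
  qed
  have "fs.dim U + fs.dim {\<eta> \<in> ext 3 V5. \<forall>\<beta>\<in>U. p \<eta> \<beta> = 0} = card ?I"
  proof (rule dim_annihilator[OF fs.vector_space_axioms fs.vector_space_axioms _ span F _ _ _ U])
    fix S T assume S: "S \<in> ?I" and T: "T \<in> ?I"
    have "p (d T) (dec (ls S)) = 1 / c T * dec (ls (B - T) @ ls S) \<omega>"
      by (simp add: p_def d_def wedge_scale_left wedge_dec fun_simps)
    also have "\<dots> = (if S = T then 1 else 0)"
    proof (cases "S = T")
      case True
      then show ?thesis
        using c[OF T] by (simp add: c_def)
    next
      case False
      \<comment> \<open>Both sets have two elements, so \<open>S\<close> different from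
        \<open>T\<close> must meet \<open>B - T\<close>, and a basis vector occurs twice in the
        product.\<close>
      then have "\<not> S \<subseteq> T"
        using S T B(1) by (metis (mono_tags, lifting) card_subset_eq finite_subset mem_Collect_eq)
      then have "\<not> distinct (ls (B - T) @ ls S)"
        using ls S T Diff_subset[of B T] by auto
      then show ?thesis
        using False by (simp add: dec_repeat fun_simps)
    qed
    finally show "p (d T) (dec (ls S)) = (if S = T then 1 else 0)" .
  next
    fix \<eta> assume \<eta>: "\<eta> \<in> ext 3 V5"
    show "linear_on fscale (*) (ext 2 V5) (p \<eta>)"
      by (auto simp: linear_on_def p_def wedge_add_right[OF \<eta>, of _ 2 V5]
          wedge_scale_right[OF \<eta>, of _ 2 V5] fun_simps)
  next
    fix \<beta> assume "\<beta> \<in> ext 2 V5"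
    show "linear_on fscale (*) (ext 3 V5) (\<lambda>\<eta>. p \<eta> \<beta>)"
      by (auto simp: linear_on_def p_def wedge_add_left wedge_scale_left fun_simps)
  qed (use B(1) in simp)
  also have "{\<eta> \<in> ext 3 V5. \<forall>\<beta>\<in>U. p \<eta> \<beta> = 0} = {\<eta> \<in> ext 3 V5. \<forall>\<beta>\<in>U. wdg \<eta> \<beta> = 0}"
    using p_eq_0 U(2) by blast
  also have "card ?I = 10"
    using n_subsets[OF B(1), of 2] B(2) by (simp add: choose_two)
  finally show ?thesis .
qed

end

section \<open>Components along \<open>v\<close> and the line \<open>L \<otimes> L\<close>\<close>

context split_hyperplane
begin

lemma vw_vw: "\<beta> \<in> ext p U \<Longrightarrow> vw (vw \<beta>) = 0"
proof -
  assume "\<beta> \<in> ext p U"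
  then have "\<beta> \<in> ext p U \<and> vw (vw \<beta>) = 0"
  proof (induction rule: ext_induct)
    case zero
    show ?case
      using ext_closed(1) by (simp add: wedge_zero_right[OF v_in_ext])
  next
    case (add \<xi> \<eta>)
    then show ?case
      by (simp add: ext_closed wedge_add_right[OF v_in_ext, of _ p U]
          wedge_add_right[OF v_in_ext, of _ "Suc p" UNIV] vw_in_ext[of _ p U])
  next
    case (scale c \<xi>)
    then show ?case
      by (simp add: ext_closed wedge_scale_right[OF v_in_ext, of _ p U]
          wedge_scale_right[OF v_in_ext, of _ "Suc p" UNIV] vw_in_ext[of _ p U])
  next
    case (dec us)
    then show ?case
      by (simp add: wedge_dec dec_in_ext dec_repeat)
  qed
  then show ?thesis ..
qed

text \<open>If \<open>\<xi> = \<alpha> + v \<and> \<beta>\<close> with \<open>\<alpha>\<close> and \<open>\<beta>\<close> over \<open>V\<^sub>5\<close>, then \<open>prt \<xi> = \<alpha>\<close> and \<open>con \<xi> = \<beta>\<close>.\<close>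

abbreviation "prt \<xi> \<equiv> con (vw \<xi>)"

text \<open>Wedging with \<open>v\<close> kills \<open>vw \<beta>\<close>; contracting with
  \<open>l\<close> then returns \<open>\<alpha>\<close>.\<close>

lemma part_split:
  assumes "\<xi> \<in> ext (Suc p) UNIV"
  shows "prt \<xi> \<in> ext (Suc p) V5" "\<xi> = prt \<xi> + vw (con \<xi>)"
proof -
  obtain \<alpha> \<beta> where *: "\<alpha> \<in> ext (Suc p) V5" "\<beta> \<in> ext p V5" "\<xi> = \<alpha> + vw \<beta>"
    using decompose[OF assms] .
  have "\<alpha> \<in> ext (Suc p) UNIV"
    using *(1) ext_mono by blast
  then have "vw \<xi> = vw \<alpha>"
    using * vw_vw by (simp add: wedge_add_right[OF v_in_ext _ vw_in_ext, of _ p])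
  then have "prt \<xi> = \<alpha>"
    using * contract_vw[OF l] by (simp add: lv)
  then show "prt \<xi> \<in> ext (Suc p) V5" "\<xi> = prt \<xi> + vw (con \<xi>)"
    using * con_split by auto
qed

lemma L_tensor_eq:
  assumes "m \<in> LL" "m' \<in> LL"
  shows "L_tensor m m' = fscale (m v * m' v) (L_tensor l l)"
proof -
  have *: "m x = m v * l x" "m' x = m' v * l x" for x
    using L_eq[OF v assms(1) l lv] L_eq[OF v assms(2) l lv] by (metis fscale_apply)+
  show ?thesis
  proof
    fix p :: "'b \<times> 'b"
    obtain x y where p: "p = (x, y)"
      by (cases p)
    show "L_tensor m m' p = fscale (m v * m' v) (L_tensor l l) p"
      using *(1)[of x] *(2)[of y] by (simp add: p L_tensor_def fscale_apply)
  qed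
qed

text \<open>\<open>L \<otimes> L\<close> is spanned by \<open>L_tensor l l\<close>, whose value at
  \<open>(v, v)\<close> is 1, so evaluation there reads off the coefficient.\<close>

lemma L_square_eq:
  assumes "f \<in> L_square s V5"
  shows "f = fscale (f (v, v)) (L_tensor l l)"
proof -
  have "f \<in> fs.span {L_tensor m m' | m m'. m \<in> LL \<and> m' \<in> LL}"
    using assms by (simp add: L_square_def)
  moreover have "L_tensor m m' \<in> fs.span {L_tensor l l}" if "m \<in> LL" "m' \<in> LL" for m m'
    unfolding L_tensor_eq[OF that] by (intro fs.span_scale fs.span_base) simp
  then have "fs.span {L_tensor m m' | m m'. m \<in> LL \<and> m' \<in> LL} \<subseteq> fs.span {L_tensor l l}"
    by (intro fs.span_minimal fs.subspace_span) auto
  ultimately have "f \<in> fs.span {L_tensor l l}"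
    by blast
  then show ?thesis
    by (auto simp: fs.span_singleton L_tensor_def lv fun_simps)
qed

end

section \<open>The Lagrangian subspace and the form \<open>q\<^sub>0\<close>\<close>

locale split_lagrangian = split_hyperplane s V5 v l
  for s :: "'k::field \<Rightarrow> 'v::ab_group_add \<Rightarrow> 'v" and V5 v l +
  fixes A and \<epsilon> :: "('v, 'k) multivector \<Rightarrow> 'v \<times> 'v \<Rightarrow> 'k"
  assumes lagrangian_A: "lagrangian fscale (ext 3 UNIV) wdg A"
    and eps: "linear_iso_on fscale fscale (ext 5 V5) (L_square s V5) \<epsilon>"
begin

lemma subspace_A: "fs.subspace A"
  and A_ext: "\<xi> \<in> A \<Longrightarrow> \<xi> \<in> ext 3 UNIV"
  and A_iff: "\<xi> \<in> A \<longleftrightarrow> \<xi> \<in> ext 3 UNIV \<and> (\<forall>\<xi>'\<in>A. wdg \<xi> \<xi>' = 0)"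
proof -
  have "fs.subspace A" "A \<subseteq> ext 3 UNIV" and A: "A = {\<xi> \<in> ext 3 UNIV. \<forall>\<xi>'\<in>A. wdg \<xi> \<xi>' = 0}"
    using lagrangian_A unfolding lagrangian_def by blast+
  then show "fs.subspace A" "\<xi> \<in> A \<Longrightarrow> \<xi> \<in> ext 3 UNIV"
    by blast+
  show "\<xi> \<in> A \<longleftrightarrow> \<xi> \<in> ext 3 UNIV \<and> (\<forall>\<xi>'\<in>A. wdg \<xi> \<xi>' = 0)"
    by (subst A) simp
qed

lemma con_A: "\<xi> \<in> A \<Longrightarrow> con \<xi> \<in> ext 2 V5"
  and part_A: "\<xi> \<in> A \<Longrightarrow> prt \<xi> \<in> ext 3 V5"
  and split_A: "\<xi> \<in> A \<Longrightarrow> \<xi> = prt \<xi> + vw (con \<xi>)"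
  using con_in_ext[of \<xi> 2] part_split[of \<xi> 2] A_ext[of \<xi>] by simp_all

lemma lam_l: "lam s V5 \<xi> l = con \<xi>"
  using l by (simp add: lam_def)

lemma lam_eq_iff:
  assumes "\<xi> \<in> ext 3 UNIV" "\<xi>' \<in> ext 3 UNIV"
  shows "lam s V5 \<xi> = lam s V5 \<xi>' \<longleftrightarrow> con \<xi> = con \<xi>'"
proof
  assume "con \<xi> = con \<xi>'"
  then show "lam s V5 \<xi> = lam s V5 \<xi>'"
    using contract_eq[of _ \<xi> 2] contract_eq[of _ \<xi>' 2] assms by (intro ext) (simp add: lam_def)
qed (metis lam_l)

lemma lam_linear: "Vector_Spaces.linear fscale twisted_scale (lam s V5)"
  unfolding Vector_Spaces.linear_iff
  using fs.vector_space_axioms tw.vector_space_axioms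
  by (auto simp: lam_def twisted_scale_def fun_eq_iff contract_add contract_scale fun_simps)

lemma lam_eq_0_iff:
  assumes "\<xi> \<in> A"
  shows "lam s V5 \<xi> = 0 \<longleftrightarrow> \<xi> \<in> ext 3 V5"
proof -
  have "lam s V5 0 = 0"
    by (auto simp: lam_def fun_eq_iff contract_zero fun_simps)
  then show ?thesis
    using lam_eq_iff[OF A_ext[OF assms], of 0] con_eq_0_iff[of \<xi> 2] A_ext[OF assms] ext_closed(1)
    by (simp add: contract_zero)
qed

text \<open>By \<open>wedge_eq_0_iff\<close> the condition says that \<open>\<eta>\<close> is
  orthogonal to \<open>A\<close>, and a Lagrangian contains every vector orthogonal to it. This fact
  underlies \<open>W0_perp_eq\<close>, the well-definedness of \<open>q0\<close>, its kernel and the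
  dimension count.\<close>

lemma annihilator_eq: "{\<eta> \<in> ext 3 V5. \<forall>\<xi>\<in>A. wdg \<eta> (con \<xi>) = 0} = A \<inter> ext 3 V5"
proof -
  have "\<eta> \<in> A \<longleftrightarrow> (\<forall>\<xi>\<in>A. wdg \<eta> (con \<xi>) = 0)" if "\<eta> \<in> ext 3 V5" for \<eta>
    using that wedge_eq_0_iff[OF that A_ext] A_iff[of \<eta>] ext_mono[of V5 UNIV 3] by auto
  then show ?thesis
    by blast
qed

lemma W0_perp_eq: "W0_perp s V5 A = A \<inter> ext 3 V5"
proof -
  have "(\<forall>m\<in>LL. wdg \<eta> (lam s V5 \<xi> m) = 0) \<longleftrightarrow> wdg \<eta> (con \<xi>) = 0"
    if \<eta>: "\<eta> \<in> ext 3 V5" and \<xi>: "\<xi> \<in> A" for \<eta> \<xi>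
  proof
    assume "\<forall>m\<in>LL. wdg \<eta> (lam s V5 \<xi> m) = 0"
    then show "wdg \<eta> (con \<xi>) = 0"
      using l lam_l by metis
  next
    assume 0: "wdg \<eta> (con \<xi>) = 0"
    show "\<forall>m\<in>LL. wdg \<eta> (lam s V5 \<xi> m) = 0"
    proof
      fix m assume "m \<in> LL"
      then have "lam s V5 \<xi> m = fscale (m v) (con \<xi>)"
        using contract_eq[of m \<xi> 2] A_ext[OF \<xi>] by (simp add: lam_def)
      then show "wdg \<eta> (lam s V5 \<xi> m) = 0"
        using wedge_scale_right[OF \<eta> con_A[OF \<xi>]] 0 by simp
    qed
  qed
  then show ?thesis
    unfolding annihilator_eq[symmetric] W0_perp_def W0_def by blast
qed

lemma eps_linear: "linear_on fscale fscale (ext 5 V5) \<epsilon>"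
  and eps_bij: "bij_betw \<epsilon> (ext 5 V5) (L_square s V5)"
  using eps by (auto simp: linear_iso_on_def)

lemma eps_0: "\<epsilon> 0 = 0"
  using linear_on_zero[OF fs.vector_space_axioms fs.vector_space_axioms eps_linear] ext_closed(1) by blast

lemma eps_eq:
  assumes "z \<in> ext 5 V5"
  shows "\<epsilon> z = fscale (\<epsilon> z (v, v)) (L_tensor l l)"
  using assms eps_bij by (intro L_square_eq) (auto simp: bij_betw_def)

lemma eps_eq_0_iff:
  assumes "z \<in> ext 5 V5"
  shows "\<epsilon> z (v, v) = 0 \<longleftrightarrow> z = 0"
proof
  assume "\<epsilon> z (v, v) = 0"
  then have "\<epsilon> z = \<epsilon> 0"
    using eps_eq[OF assms] by (simp add: eps_0)
  then show "z = 0"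
    using eps_bij assms ext_closed(1) by (metis bij_betw_def inj_on_def)
qed (simp add: eps_0 fun_simps)

text \<open>As \<open>\<epsilon>\<close> maps onto \<open>L \<otimes> L\<close>, which contains the
  nonzero \<open>L_tensor l l\<close>, this follows without constructing an alternating
  5-form.\<close>

lemma ext_5_V5: "ext 5 V5 \<noteq> {0}"
proof
  assume "ext 5 V5 = {0}"
  then have "L_square s V5 = {0}"
    using eps_bij eps_0 by (auto simp: bij_betw_def)
  moreover have "L_tensor l l \<in> L_square s V5"
    unfolding L_square_def using l by (intro fs.span_base) auto
  ultimately have "L_tensor l l (v, v) = 0"
    by (simp add: fun_simps)
  then show False
    by (simp add: L_tensor_def lv)
qed

text \<open>For \<open>m = m' = l\<close> the defining equation forces the scalar; for general
  \<open>m\<close>, \<open>m'\<close> both sides acquire the same factor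
  \<open>m v * m' v\<close>.\<close>

lemma eps_pairing_eq:
  assumes a: "a \<in> ext 3 V5" "\<And>m. m \<in> LL \<Longrightarrow> \<alpha> m = fscale (m v) a"
    and b: "b \<in> ext 2 V5" "\<And>m. m \<in> LL \<Longrightarrow> \<beta> m = fscale (m v) b"
  shows "eps_pairing s V5 \<epsilon> \<alpha> \<beta> = \<epsilon> (wdg a b) (v, v)"
  unfolding eps_pairing_def
proof (rule the_equality)
  have z: "wdg a b \<in> ext 5 V5"
    using wedge_in_ext[OF a(1) b(1)] by simp
  show "\<forall>m\<in>LL. \<forall>m'\<in>LL. \<epsilon> (wdg (\<alpha> m) (\<beta> m')) = fscale (\<epsilon> (wdg a b) (v, v)) (L_tensor m m')"
  proof (intro ballI)
    fix m m' assume m: "m \<in> LL" "m' \<in> LL"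
    have "wdg (\<alpha> m) (\<beta> m') = fscale (m v * m' v) (wdg a b)"
      using a b m by (simp add: wedge_scale_left wedge_scale_right[OF a(1) b(1)])
    then have "\<epsilon> (wdg (\<alpha> m) (\<beta> m')) = fscale (m v * m' v) (\<epsilon> (wdg a b))"
      using eps_linear z by (simp add: linear_on_def)
    also have "\<dots> = fscale (m v * m' v) (fscale (\<epsilon> (wdg a b) (v, v)) (L_tensor l l))"
      using eps_eq[OF z] by simp
    finally show "\<epsilon> (wdg (\<alpha> m) (\<beta> m')) = fscale (\<epsilon> (wdg a b) (v, v)) (L_tensor m m')"
      by (simp add: L_tensor_eq[OF m] mult.commute)
  qed
  fix c assume "\<forall>m\<in>LL. \<forall>m'\<in>LL. \<epsilon> (wdg (\<alpha> m) (\<beta> m')) = fscale c (L_tensor m m')"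
  then have "\<epsilon> (wdg a b) = fscale c (L_tensor l l)"
    using l a(2)[OF l] b(2)[OF l] lv by (metis fs.scale_one)
  then show "c = \<epsilon> (wdg a b) (v, v)"
    by (simp add: L_tensor_def lv fun_simps)
qed

lemma q0_eq:
  assumes \<xi>: "\<xi>1 \<in> A" "\<xi>2 \<in> A"
  shows "q0 s V5 A \<epsilon> v (lam s V5 \<xi>1) (lam s V5 \<xi>2) = - \<epsilon> (wdg (prt \<xi>1) (con \<xi>2)) (v, v)"
proof -
  have pairing: "eps_pairing s V5 \<epsilon> (lam s V5 (vw \<zeta>1)) (lam s V5 \<zeta>2) = \<epsilon> (wdg (prt \<zeta>1) (con \<zeta>2)) (v, v)"
    if "\<zeta>1 \<in> A" "\<zeta>2 \<in> A" for \<zeta>1 \<zeta>2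
  proof (rule eps_pairing_eq)
    show "prt \<zeta>1 \<in> ext 3 V5" "con \<zeta>2 \<in> ext 2 V5"
      using that part_A con_A by blast+
    fix m assume m: "m \<in> LL"
    show "lam s V5 (vw \<zeta>1) m = fscale (m v) (prt \<zeta>1)"
      using contract_eq[OF m vw_in_ext[OF A_ext[OF that(1)]]] m by (simp add: lam_def)
    show "lam s V5 \<zeta>2 m = fscale (m v) (con \<zeta>2)"
      using contract_eq[OF m, of \<zeta>2 2] A_ext[OF that(2)] m by (simp add: lam_def)
  qed
  \<comment> \<open>Another preimage changes \<open>prt \<xi>1\<close> by an element of
    \<open>A \<inter> ext 3 V5\<close>, which wedges to 0 with \<open>con \<xi>2\<close> by
    \<open>annihilator_eq\<close>; the second argument enters through \<open>con\<close>
    only.\<close>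
  have indep: "wdg (prt \<zeta>1) (con \<zeta>2) = wdg (prt \<xi>1) (con \<xi>2)"
    if \<zeta>: "\<zeta>1 \<in> A" "\<zeta>2 \<in> A" and eq: "lam s V5 \<zeta>1 = lam s V5 \<xi>1" "lam s V5 \<zeta>2 = lam s V5 \<xi>2" for \<zeta>1 \<zeta>2
  proof -
    have con: "con \<zeta>1 = con \<xi>1" "con \<zeta>2 = con \<xi>2"
      using eq lam_l by metis+
    have "prt \<zeta>1 - prt \<xi>1 = \<zeta>1 - \<xi>1"
      using split_A[OF \<zeta>(1)] split_A[OF \<xi>(1)] con(1) by (metis add_diff_cancel_right)
    moreover have "\<zeta>1 - \<xi>1 \<in> A"
      using \<zeta> \<xi> subspace_A fs.subspace_diff by blast
    moreover have "prt \<zeta>1 - prt \<xi>1 \<in> ext 3 V5"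
      using part_A \<zeta> \<xi> ext_closed(3) by blast
    ultimately have "wdg (prt \<zeta>1 - prt \<xi>1) (con \<xi>2) = 0"
      using annihilator_eq \<xi>(2) by auto
    then show ?thesis
      using wedge_add_left[of "prt \<zeta>1 - prt \<xi>1" "prt \<xi>1" "con \<xi>2"] con by simp
  qed
  show ?thesis
    unfolding q0_def
  proof (rule the_equality)
    show "\<exists>\<zeta>1\<in>A. \<exists>\<zeta>2\<in>A. lam s V5 \<zeta>1 = lam s V5 \<xi>1 \<and> lam s V5 \<zeta>2 = lam s V5 \<xi>2 \<and>
        - \<epsilon> (wdg (prt \<xi>1) (con \<xi>2)) (v, v) = - eps_pairing s V5 \<epsilon> (lam s V5 (vw \<zeta>1)) (lam s V5 \<zeta>2)"
      using \<xi> pairing[OF \<xi>] by (intro bexI[of _ \<xi>1] bexI[of _ \<xi>2]) simp_all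
  next
    fix c assume "\<exists>\<zeta>1\<in>A. \<exists>\<zeta>2\<in>A. lam s V5 \<zeta>1 = lam s V5 \<xi>1 \<and> lam s V5 \<zeta>2 = lam s V5 \<xi>2 \<and>
        c = - eps_pairing s V5 \<epsilon> (lam s V5 (vw \<zeta>1)) (lam s V5 \<zeta>2)"
    then obtain \<zeta>1 \<zeta>2 where \<zeta>: "\<zeta>1 \<in> A" "\<zeta>2 \<in> A"
      "lam s V5 \<zeta>1 = lam s V5 \<xi>1" "lam s V5 \<zeta>2 = lam s V5 \<xi>2"
      and c: "c = - eps_pairing s V5 \<epsilon> (lam s V5 (vw \<zeta>1)) (lam s V5 \<zeta>2)"
      by blast
    show "c = - \<epsilon> (wdg (prt \<xi>1) (con \<xi>2)) (v, v)"
      unfolding c pairing[OF \<zeta>(1,2)] indep[OF \<zeta>] ..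
  qed
qed

lemma q0_eq_0_iff:
  assumes "\<xi>1 \<in> A" "\<xi>2 \<in> A"
  shows "q0 s V5 A \<epsilon> v (lam s V5 \<xi>1) (lam s V5 \<xi>2) = 0 \<longleftrightarrow> wdg (prt \<xi>1) (con \<xi>2) = 0"
proof -
  have "wdg (prt \<xi>1) (con \<xi>2) \<in> ext 5 V5"
    using wedge_in_ext[OF part_A[OF assms(1)] con_A[OF assms(2)]] by simp
  then show ?thesis
    using q0_eq[OF assms] eps_eq_0_iff by simp
qed

text \<open>For \<open>\<xi>\<close> giving a kernel vector, \<open>prt \<xi>\<close> lies in
  \<open>A\<close>, so \<open>\<xi>\<close> may be replaced by
  \<open>\<xi> - prt \<xi> = vw (con \<xi>)\<close> without changing its image. Conversely
  \<open>prt\<close> vanishes on products with \<open>v\<close>.\<close>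

lemma q0_kernel:
  "{w \<in> W0 s V5 A. \<forall>w'\<in>W0 s V5 A. q0 s V5 A \<epsilon> v w w' = 0} = lam s V5 ` (A \<inter> vw ` ext 2 V5)"
proof (intro equalityI subsetI)
  fix w assume w: "w \<in> {w \<in> W0 s V5 A. \<forall>w'\<in>W0 s V5 A. q0 s V5 A \<epsilon> v w w' = 0}"
  then obtain \<xi> where \<xi>: "\<xi> \<in> A" "w = lam s V5 \<xi>"
    by (auto simp: W0_def)
  then have "\<forall>\<xi>'\<in>A. wdg (prt \<xi>) (con \<xi>') = 0"
    using w q0_eq_0_iff[OF \<xi>(1)] by (auto simp: W0_def)
  then have "prt \<xi> \<in> A"
    using annihilator_eq part_A[OF \<xi>(1)] by blast
  moreover have *: "vw (con \<xi>) = \<xi> - prt \<xi>"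
    using split_A[OF \<xi>(1)] by (metis add_diff_cancel_left')
  ultimately have A: "vw (con \<xi>) \<in> A"
    using \<xi>(1) subspace_A fs.subspace_diff by metis
  have "con (vw (con \<xi>)) = con \<xi>"
    using contract_vw[OF l con_A[OF \<xi>(1)]] by (simp add: lv)
  then have "w = lam s V5 (vw (con \<xi>))"
    using lam_eq_iff A_ext A \<xi> by simp
  then show "w \<in> lam s V5 ` (A \<inter> vw ` ext 2 V5)"
    using A con_A[OF \<xi>(1)] by blast
next
  fix w assume "w \<in> lam s V5 ` (A \<inter> vw ` ext 2 V5)"
  then obtain \<beta> where \<beta>: "\<beta> \<in> ext 2 V5" "vw \<beta> \<in> A" "w = lam s V5 (vw \<beta>)"
    by blast
  have "prt (vw \<beta>) = 0"
    using vw_vw[OF \<beta>(1)] by (simp add: contract_zero)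
  then show "w \<in> {w \<in> W0 s V5 A. \<forall>w'\<in>W0 s V5 A. q0 s V5 A \<epsilon> v w w' = 0}"
    using \<beta> q0_eq_0_iff[OF \<beta>(2)] by (auto simp: W0_def wedge_zero_left)
qed

lemma inj_on_lam: "inj_on (lam s V5) (A \<inter> vw ` ext 2 V5)"
proof (rule inj_onI)
  fix x y assume xy: "x \<in> A \<inter> vw ` ext 2 V5" "y \<in> A \<inter> vw ` ext 2 V5" "lam s V5 x = lam s V5 y"
  then obtain \<beta> \<gamma> where *: "\<beta> \<in> ext 2 V5" "x = vw \<beta>" "\<gamma> \<in> ext 2 V5" "y = vw \<gamma>"
    by blast
  have "con x = con y"
    using xy(3) lam_l by metis
  then show "x = y"
    using * contract_vw[OF l] by (simp add: lv)
qed

text \<open>Evaluation at \<open>l\<close> maps \<open>W0\<close> isomorphically onto the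
  contractions of \<open>A\<close> by \<open>l\<close>, a subspace of \<open>ext 2 V5\<close> with
  annihilator \<open>A \<inter> ext 3 V5\<close>.\<close>

lemma W0_dim:
  "tw.dim (W0 s V5 A) + fs.dim (A \<inter> ext 3 V5) = 10"
  "\<exists>S. finite S \<and> W0 s V5 A \<subseteq> tw.span S" "tw.subspace (W0 s V5 A)"
proof -
  interpret lam: vector_space_pair fscale "twisted_scale :: 'k \<Rightarrow> ('v, 'k) twisted \<Rightarrow> _"
    by unfold_locales
  interpret ev: vector_space_pair "twisted_scale :: 'k \<Rightarrow> ('v, 'k) twisted \<Rightarrow> _" fscale
    by unfold_locales
  show sub: "tw.subspace (W0 s V5 A)"
    unfolding W0_def using lam.linear_subspace_image[OF lam_linear subspace_A] .
  have ev: "Vector_Spaces.linear twisted_scale fscale (\<lambda>t :: ('v, 'k) twisted. t l)"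
    unfolding Vector_Spaces.linear_iff
    using fs.vector_space_axioms tw.vector_space_axioms by (auto simp: twisted_scale_def fun_simps)
  have im: "(\<lambda>t. t l) ` W0 s V5 A = con ` A"
    by (simp add: W0_def image_image lam_l)
  have inj: "inj_on (\<lambda>t. t l) (W0 s V5 A)"
    using lam_eq_iff[OF A_ext A_ext] by (auto simp: inj_on_def W0_def lam_l)
  have "fs.subspace (con ` A)"
    using ev.linear_subspace_image[OF ev sub] im by simp
  moreover have con_sub: "con ` A \<subseteq> ext 2 V5"
    using con_A by blast
  ultimately have "fs.dim (con ` A) + fs.dim {\<eta> \<in> ext 3 V5. \<forall>\<beta>\<in>con ` A. wdg \<eta> \<beta> = 0} = 10"
    by (rule dim_wedge_annihilator[OF ext_5_V5])
  moreover have "fs.dim (con ` A) = tw.dim (W0 s V5 A)"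
    using ev.dim_image_inj[OF ev sub inj] im by simp
  moreover have "{\<eta> \<in> ext 3 V5. \<forall>\<beta>\<in>con ` A. wdg \<eta> \<beta> = 0} = A \<inter> ext 3 V5"
    unfolding annihilator_eq[symmetric] by simp
  ultimately show "tw.dim (W0 s V5 A) + fs.dim (A \<inter> ext 3 V5) = 10"
    by simp
  \<comment> \<open>Finiteness of a basis of \<open>W0\<close>, required by
    \<open>dim_times_UNIV\<close>, is inherited from \<open>ext 2 V5\<close> through the same
    evaluation.\<close>
  obtain C where C: "C \<subseteq> W0 s V5 A" "tw.independent C" "W0 s V5 A \<subseteq> tw.span C"
    by (rule tw.basis_exists)
  have span: "tw.span C \<subseteq> W0 s V5 A"
    using C(1) sub by (rule tw.span_minimal)
  have "fs.independent ((\<lambda>t. t l) ` C)"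
    using ev.linear_independent_injective_image[OF ev C(2)] inj_on_subset[OF inj span] by blast
  moreover obtain S where S: "finite S" "ext 2 V5 = fs.span S"
    using ext_V5_finite by blast
  moreover have "(\<lambda>t. t l) ` C \<subseteq> ext 2 V5"
    using image_mono[OF C(1), of "\<lambda>t. t l"] con_sub unfolding im by (rule order_trans)
  ultimately have "finite ((\<lambda>t. t l) ` C)"
    using fs.independent_span_bound[of S "(\<lambda>t. t l) ` C"] by simp
  then have "finite C"
    using inj_on_subset[OF inj C(1)] finite_imageD by blast
  then show "\<exists>S. finite S \<and> W0 s V5 A \<subseteq> tw.span S"
    using C(3) by blast
qed

end

section \<open>The line \<open>A\<^sub>1\<close> and the form \<open>q\<^sub>1\<close>\<close>

context hyperplane
begin

lemma A1_iff:
  assumes "lagrangian kL_scale (UNIV \<times> LL) kL_form A1"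
  shows "p \<in> A1 \<longleftrightarrow> p \<in> UNIV \<times> LL \<and> (\<forall>p'\<in>A1. fscale (fst p) (snd p') = fscale (fst p') (snd p))"
proof -
  have A1: "A1 = {p \<in> UNIV \<times> LL. \<forall>p'\<in>A1. kL_form p p' = 0}"
    using assms unfolding lagrangian_def by blast
  show ?thesis
    by (subst A1) (simp add: kL_form_def)
qed

lemma W1_perp_eq:
  assumes A1: "lagrangian kL_scale (UNIV \<times> LL) kL_form A1"
  shows "{0} \<times> W1_perp s V5 A1 = A1 \<inter> ({0} \<times> LL)"
proof -
  have "m \<in> W1_perp s V5 A1 \<longleftrightarrow> (0, m) \<in> A1" for m
    unfolding A1_iff[OF A1, of "(0, m)"]
    by (auto simp: W1_perp_def W1_def kL_form_def eq_commute[of 0])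
  then show ?thesis
    by (auto simp: W1_perp_def)
qed

lemma W1_quotient:
  assumes A1: "lagrangian kL_scale (UNIV \<times> LL) kL_form A1"
  shows "induces_quotient_iso kL_scale (*) fst A1 (A1 \<inter> ({0} \<times> LL)) (W1 A1)"
proof (rule induces_quotient_isoI[OF kL.vector_space_axioms])
  show "kL.subspace A1"
    using A1 by (simp add: lagrangian_def)
  show "A1 \<inter> ({0} \<times> LL) = {p \<in> A1. fst p = 0}"
    using A1 by (auto simp: lagrangian_def)
qed (auto simp: linear_on_def kL_scale_def W1_def)

lemma W1_zero: "A1_is_zero s V5 A1 \<Longrightarrow> W1 A1 = {0}"
  using fs.subspace_0[OF subspace_L] by (auto simp: A1_is_zero_def W1_def)

text \<open>If all first coordinates in \<open>A1\<close> vanish then \<open>A1\<close> is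
  \<open>L\<close>, which is excluded; otherwise rescaling one element reaches every scalar.\<close>

lemma W1_one:
  assumes A1: "lagrangian kL_scale (UNIV \<times> LL) kL_form A1" and one: "A1_is_one s V5 A1"
  shows "W1 A1 = UNIV"
proof -
  have "\<exists>p\<in>A1. fst p \<noteq> 0"
  proof (rule ccontr)
    assume "\<not> ?thesis"
    then have "A1 \<subseteq> {0} \<times> LL"
      using A1 by (auto simp: lagrangian_def)
    \<comment> \<open>Elements of \<open>{0} \<times> LL\<close> pair to 0 with each other, hence
      with \<open>A1\<close>, and the Lagrangian condition puts them into \<open>A1\<close>.\<close>
    moreover have "{0} \<times> LL \<subseteq> A1"
    proof
      fix p :: "'k \<times> ('v \<Rightarrow> 'k)" assume "p \<in> {0} \<times> LL"
      then show "p \<in> A1"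
        using \<open>A1 \<subseteq> {0} \<times> LL\<close> by (subst A1_iff[OF A1]) auto
    qed
    ultimately show False
      using one by (auto simp: A1_is_one_def A1_is_zero_def)
  qed
  then obtain x m where x: "(x, m) \<in> A1" "x \<noteq> 0"
    by auto
  have "y \<in> W1 A1" for y
  proof -
    have "kL_scale (y / x) (x, m) \<in> A1"
      using A1 x(1) by (intro kL.subspace_scale) (simp_all add: lagrangian_def)
    then show ?thesis
      using x(2) unfolding W1_def by (intro image_eqI) (simp_all add: kL_scale_def)
  qed
  then show ?thesis
    by blast
qed

end

context split_hyperplane
begin

text \<open>Isotropy of \<open>A1\<close> is the symmetry \<open>x1 * m2 v = x2 * m1 v\<close>,
  which removes the dependence on the chosen second coordinates.\<close>

lemma q1_eq:
  assumes A1: "lagrangian kL_scale (UNIV \<times> LL) kL_form A1" and p: "(x1, m1) \<in> A1" "(x2, m2) \<in> A1"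
  shows "q1 A1 v x1 x2 = x1 * m2 v"
  unfolding q1_def
proof (rule the_equality)
  have sym: "x * m' v = x' * m v" if "(x, m) \<in> A1" "(x', m') \<in> A1" for x m x' m'
    using A1_iff[OF A1, of "(x, m)"] that by (auto simp: fun_eq_iff fscale_apply)
  fix c assume "\<exists>m1' m2'. (x1, m1') \<in> A1 \<and> (x2, m2') \<in> A1 \<and> c = x1 * m2' v"
  then obtain m2' where "(x2, m2') \<in> A1" "c = x1 * m2' v"
    by blast
  then show "c = x1 * m2 v"
    using sym[OF p(1)] p by metis
qed (use p in blast)

text \<open>If \<open>x\<close> were nonzero, every element of \<open>A1\<close> would have a second
  coordinate vanishing at \<open>v\<close>, hence zero, and \<open>A1\<close> would be the excluded
  value \<infinity>.\<close>

lemma q1_kernel: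
  assumes A1: "lagrangian kL_scale (UNIV \<times> LL) kL_form A1" and "\<not> A1_is_infinity A1"
    and x: "x \<in> W1 A1" "\<And>x'. x' \<in> W1 A1 \<Longrightarrow> q1 A1 v x x' = 0"
  shows "x = 0"
proof (rule ccontr)
  assume "x \<noteq> 0"
  obtain m where m: "(x, m) \<in> A1"
    using x(1) by (auto simp: W1_def)
  have A1_sub: "m' \<in> LL" if "(x', m') \<in> A1" for x' m'
    using A1 that by (auto simp: lagrangian_def)
  have zero: "m' = 0" if "(x', m') \<in> A1" for x' m'
  proof -
    have "x' \<in> W1 A1"
      using that by (force simp: W1_def)
    then have "m' v = 0"
      using q1_eq[OF A1 m that] x(2) \<open>x \<noteq> 0\<close> by simp
    then show ?thesis
      using L_eq[OF v A1_sub[OF that] l lv] by simp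
  qed
  \<comment> \<open>All second coordinates in \<open>A1\<close> are 0, so \<open>(c, 0)\<close> is
    orthogonal to \<open>A1\<close> and therefore belongs to it.\<close>
  have "(c, 0) \<in> A1" for c
    using zero fs.subspace_0[OF subspace_L] by (subst A1_iff[OF A1]) auto
  then have "A1 = UNIV \<times> {0}"
    using zero by auto
  then show False
    using assms(2) by (simp add: A1_is_infinity_def)
qed

end

section \<open>The quotient presentation of \<open>W0\<close> and the kernel of
  \<open>q(v)\<close>\<close>

context split_lagrangian
begin

lemma W0_quotient:
  "induces_quotient_iso fscale twisted_scale (lam s V5) A (A \<inter> ext 3 V5) (W0 s V5 A)"
proof (rule induces_quotient_isoI[OF fs.vector_space_axioms subspace_A])
  show "linear_on fscale twisted_scale A (lam s V5)"
    using lam_linear by (auto simp: linear_on_def Vector_Spaces.linear_iff)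
  show "A \<inter> ext 3 V5 = {\<xi> \<in> A. lam s V5 \<xi> = 0}"
    using lam_eq_0_iff by blast
qed (simp add: W0_def)

text \<open>\<open>q(v)\<close> is an orthogonal sum, so testing against \<open>(w', 0)\<close> and
  \<open>(0, x')\<close> separates the two kernels; the second one is zero by
  \<open>q1_kernel\<close>.\<close>

lemma kernel_eq:
  assumes A1: "lagrangian kL_scale (UNIV \<times> LL) kL_form A1" and "\<not> A1_is_infinity A1"
  shows "form_kernel (WX s V5 A A1) (q s V5 A A1 \<epsilon> v) = (\<lambda>\<xi>. (lam s V5 \<xi>, 0)) ` (A \<inter> vw ` ext 2 V5)"
proof -
  have A1_0: "(0, 0) \<in> A1"
    using A1 kL.subspace_0 by (auto simp: lagrangian_def zero_prod_def)
  then have W1_0: "0 \<in> W1 A1"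
    by (force simp: W1_def)
  have q1_0: "q1 A1 v x 0 = 0" "q1 A1 v 0 x = 0" if x: "x \<in> W1 A1" for x
  proof -
    obtain m where m: "(x, m) \<in> A1"
      using x by (auto simp: W1_def)
    show "q1 A1 v x 0 = 0" "q1 A1 v 0 x = 0"
      using q1_eq[OF A1 m A1_0] q1_eq[OF A1 A1_0 m] by (simp_all add: zero_fun_apply)
  qed
  have A_0: "0 \<in> A"
    using fs.subspace_0[OF subspace_A] .
  have W0_0: "0 \<in> W0 s V5 A"
    using tw.subspace_0[OF W0_dim(3)] .
  have lam_0: "lam s V5 0 = 0"
    using lam_eq_0_iff[OF A_0] ext_closed(1) by blast
  have q0_0: "q0 s V5 A \<epsilon> v w 0 = 0" if w: "w \<in> W0 s V5 A" for w
  proof -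
    obtain \<xi> where \<xi>: "\<xi> \<in> A" "w = lam s V5 \<xi>"
      using w by (auto simp: W0_def)
    then show ?thesis
      using q0_eq_0_iff[OF \<xi>(1) A_0] wedge_zero_right[OF part_A[OF \<xi>(1)]]
      by (simp add: lam_0 contract_zero)
  qed
  have "form_kernel (WX s V5 A A1) (q s V5 A A1 \<epsilon> v) =
      {w \<in> W0 s V5 A. \<forall>w'\<in>W0 s V5 A. q0 s V5 A \<epsilon> v w w' = 0} \<times> {0}"
  proof (intro equalityI subsetI)
    fix p assume p: "p \<in> form_kernel (WX s V5 A A1) (q s V5 A A1 \<epsilon> v)"
    obtain w x where wx: "p = (w, x)"
      by (cases p)
    have W: "w \<in> W0 s V5 A" "x \<in> W1 A1"
      and q: "q0 s V5 A \<epsilon> v w w' + q1 A1 v x x' = 0" if "w' \<in> W0 s V5 A" "x' \<in> W1 A1" for w' x'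
      using p that unfolding wx by (auto simp: form_kernel_def WX_def q_def)
    \<comment> \<open>The memberships were stated relative to test vectors \<open>w'\<close> and
      \<open>x'\<close>; the zero vectors discharge these premises.\<close>
    note W = W[OF W0_0 W1_0]
    have "q0 s V5 A \<epsilon> v w w' = 0" if "w' \<in> W0 s V5 A" for w'
      using q[OF that W1_0] q1_0(1)[OF W(2)] by simp
    moreover have "x = 0"
      using q[OF W0_0] q0_0[OF W(1)] by (intro q1_kernel[OF A1 assms(2) W(2)]) simp
    ultimately show "p \<in> {w \<in> W0 s V5 A. \<forall>w'\<in>W0 s V5 A. q0 s V5 A \<epsilon> v w w' = 0} \<times> {0}"
      using wx W by simp
  next
    fix p :: "('v, 'k) twisted \<times> 'k" assume p: "p \<in> {w \<in> W0 s V5 A. \<forall>w'\<in>W0 s V5 A. q0 s V5 A \<epsilon> v w w' = 0} \<times> {0}"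
    then show "p \<in> form_kernel (WX s V5 A A1) (q s V5 A A1 \<epsilon> v)"
      using W1_0 q1_0(2) by (auto simp: form_kernel_def WX_def q_def)
  qed
  also have "\<dots> = (\<lambda>\<xi>. (lam s V5 \<xi>, 0)) ` (A \<inter> vw ` ext 2 V5)"
    unfolding q0_kernel by auto
  finally show ?thesis .
qed

end

section \<open>Assembly of (a), (b) and (c)\<close>

theorem proposition3p13:
  fixes \<iota> :: "'k::field \<Rightarrow> complex"
    and s :: "'k \<Rightarrow> 'v::ab_group_add \<Rightarrow> 'v"
    and V5 :: "'v set"
    and A :: "('v, 'k) multivector set"
    and A1 :: "('k \<times> ('v \<Rightarrow> 'k)) set"
    and \<epsilon> :: "('v, 'k) multivector \<Rightarrow> 'v \<times> 'v \<Rightarrow> 'k"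
  assumes "field_embedding \<iota>"
    and "extended_lagrangian_data s V5 A A1"
    and "\<not> A1_is_infinity A1"
    and "linear_iso_on fscale fscale (ext_power s 5 V5) (L_square s V5) \<epsilon>"
  shows
    "(induces_quotient_iso fscale twisted_scale (lam s V5) A (A \<inter> ext_power s 3 V5) (W0 s V5 A) \<and>
      induces_quotient_iso kL_scale (*) fst A1 (A1 \<inter> ({0} \<times> L_space s V5)) (W1 A1) \<and>
      W0_perp s V5 A = A \<inter> ext_power s 3 V5 \<and>
      {0} \<times> W1_perp s V5 A1 = A1 \<inter> ({0} \<times> L_space s V5))
   \<and> (\<forall>v. v \<notin> V5 \<longrightarrow>
      inj_on (lam s V5) (A \<inter> wedge s (decomposable s [v]) ` ext_power s 2 V5) \<and>
      form_kernel (WX s V5 A A1) (q s V5 A A1 \<epsilon> v) =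
        (\<lambda>\<xi>. (lam s V5 \<xi>, 0)) ` (A \<inter> wedge s (decomposable s [v]) ` ext_power s 2 V5))
   \<and> (gm_variety \<iota> s V5 W_scale (WX s V5 A A1) (X_scheme \<iota> s V5 A A1 \<epsilon>) \<longrightarrow>
      (A1_is_zero s V5 A1 \<longrightarrow>
        int (scheme_dim \<iota> W_scale (WX s V5 A A1) (range \<iota>) (X_scheme \<iota> s V5 A A1 \<epsilon>))
          = 5 - int (vector_space.dim fscale (A \<inter> ext_power s 3 V5))) \<and>
      (A1_is_one s V5 A1 \<longrightarrow>
        int (scheme_dim \<iota> W_scale (WX s V5 A A1) (range \<iota>) (X_scheme \<iota> s V5 A A1 \<epsilon>))
          = 6 - int (vector_space.dim fscale (A \<inter> ext_power s 3 V5))))"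
proof -
  have V: "vector_space s" "vector_space.dim s UNIV = 6" "module.subspace s V5" "vector_space.dim s V5 = 5"
    and A: "lagrangian fscale (ext_power s 3 UNIV) (wedge s) A"
    and A1: "lagrangian kL_scale (UNIV \<times> L_space s V5) kL_form A1"
    using assms(2) by (auto simp: extended_lagrangian_data_def)
  interpret hyperplane s V5
    using V by (intro hyperplane.intro hyperplane_axioms.intro exterior.intro)
  have split: "\<exists>l. split_lagrangian s V5 v l A \<epsilon>" if v: "v \<notin> V5" for v
  proof -
    obtain l where "l \<in> L_space s V5" "l v = 1"
      by (rule exists_functional[OF v])
    then show ?thesis
      using v A assms(4)
      by (intro exI[of _ l] split_lagrangian.intro split_hyperplane.intro split_hyperplane_axioms.intro
          split_lagrangian_axioms.intro hyperplane_axioms)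
  qed
  \<comment> \<open>The statements of (a) and (c) mention no \<open>v\<close>, so any splitting
    serves; (b) chooses one for each \<open>v\<close>.\<close>
  obtain v0 where "v0 \<notin> V5"
    by (rule V5_proper)
  then obtain l0 where "split_lagrangian s V5 v0 l0 A \<epsilon>"
    using split by blast
  then interpret S: split_lagrangian s V5 v0 l0 A \<epsilon> .
  have b: "inj_on (lam s V5) (A \<inter> wedge s (decomposable s [v]) ` ext_power s 2 V5) \<and>
      form_kernel (WX s V5 A A1) (q s V5 A A1 \<epsilon> v) =
        (\<lambda>\<xi>. (lam s V5 \<xi>, 0)) ` (A \<inter> wedge s (decomposable s [v]) ` ext_power s 2 V5)"
    if v: "v \<notin> V5" for v
  proof -
    obtain l where "split_lagrangian s V5 v l A \<epsilon>"
      using split[OF v] by blast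
    then interpret S': split_lagrangian s V5 v l A \<epsilon> .
    show ?thesis
      using S'.inj_on_lam S'.kernel_eq[OF A1 assms(3)] by blast
  qed
  note W0 = S.W0_dim
  \<comment> \<open>The dimension condition in \<open>gm_variety\<close> subtracts 5 from the
    dimension of \<open>W(X)\<close>, so the totals 10 and 11 give the two formulas of (c).\<close>
  have "Wv.dim (WX s V5 A A1) + fs.dim (A \<inter> ext_power s 3 V5) = 10" if "A1_is_zero s V5 A1"
    using W0(1) dim_times_zero[OF W0(3)] by (simp add: WX_def W1_zero[OF that])
  moreover have "Wv.dim (WX s V5 A A1) + fs.dim (A \<inter> ext_power s 3 V5) = 11" if "A1_is_one s V5 A1"
    using W0(1) dim_times_UNIV[OF W0(3,2)] by (simp add: WX_def W1_one[OF A1 that])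
  ultimately show ?thesis
    using b S.W0_quotient W1_quotient[OF A1] S.W0_perp_eq W1_perp_eq[OF A1]
    unfolding gm_variety_def by auto
qed

end
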